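(* Let $c \in \mathbb{Q}$ and let $\varphi_c \colon \mathbb{Q} \to \mathbb{Q}$ be defined by $\varphi_c(x) = x^2 - c$. If $\operatorname{den}(c)$ admits at most two distinct prime factors, then every periodic point of $\varphi_c$ in $\mathbb{Q}$ has period at most $3$.
   Context: For $z \in \mathbb{Q}$, $\operatorname{den}(z) \ge 1$ is the denominator of $z$ in lowest terms. A point $x \in \mathbb{Q}$ is periodic under $\varphi_c$ if $\varphi_c^n(x) = x$ for some integer $n \ge 1$ ($n$-th iterate); the least such $n$ is the period of $x$. *)

theory Defs
  imports Complex_Main "HOL-Computational_Algebra.Primes"
begin

definition den :: "rat \<Rightarrow> int" where
  "den z = snd (quotient_of z)"

definition phi :: "rat \<Rightarrow> rat \<Rightarrow> rat" where
  "phi c x = x ^ 2 - c"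

definition periodic_point :: "('a \<Rightarrow> 'a) \<Rightarrow> 'a \<Rightarrow> bool" where
  "periodic_point f x \<longleftrightarrow> (\<exists>n\<ge>1. (f ^^ n) x = x)"

(* Meaningful only for periodic points; unspecified otherwise. *)
definition period :: "('a \<Rightarrow> 'a) \<Rightarrow> 'a \<Rightarrow> nat" where
  "period f x = (LEAST n. n \<ge> 1 \<and> (f ^^ n) x = x)"

end

theory Submission
  imports Defs "HOL-Number_Theory.Cong" "HOL-Computational_Algebra.Nth_Powers"
begin

text \<open>Bring a cycle \<open>x\<^sub>0, \<dots>, x\<^sub>n\<^sub>-\<^sub>1\<close> of \<open>x \<mapsto> x\<^sup>2 - c\<close> to its least common denominator, \<open>x\<^sub>i = X\<^sub>i / D\<close>. Then \<open>D\<close> is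
coprime to every \<open>X\<^sub>i\<close>, the denominator of \<open>c\<close> is \<open>D\<^sup>2\<close>, and
\<open>D (X\<^sub>i\<^sub>+\<^sub>1 - X\<^sub>j\<^sub>+\<^sub>1) = (X\<^sub>i - X\<^sub>j) (X\<^sub>i + X\<^sub>j)\<close>. Multiplying this identity once around the cycle shows
that every sum \<open>X\<^sub>i + X\<^sub>j\<close> of two different members divides \<open>D\<^sup>n\<close> (\<open>sum_dvd_power\<close>). For \<open>n \<ge> 3\<close> this
forces \<open>D\<close> to be even, so under the hypothesis on \<open>c\<close> the prime divisors of \<open>D\<close> are among \<open>2\<close> and one
odd prime \<open>p\<close>, and each of the sums is, up to sign, a power of \<open>2\<close> times a power of \<open>p\<close>. These few
admissible values exclude every period above three.

Period four: \<open>a = x\<^sub>0 + x\<^sub>2\<close> satisfies \<open>(a\<^sup>2 + 1) (1 - a\<^sup>2) (1 - 2 a - a\<^sup>2) = \<box>\<close>. If \<open>a = m / k\<close>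
where only \<open>2\<close> and \<open>p\<close> divide \<open>m k\<close>, then the factors are coprime up to a factor \<open>2\<close>, and
\<open>two_prime_units_not_on_curve\<close> shows that the squares so obtained cannot exist.

Residues modulo \<open>4\<close> and modulo \<open>p\<close> (where only \<open>\<plusminus>s\<close> occur) split a longer cycle into four classes. Two
members of one class have sum \<open>\<plusminus>2\<close>, so a class has at most two members, and congruences rule out four
members that agree modulo \<open>p\<close>; hence \<open>n \<le> 6\<close> (\<open>n_le_6\<close>).

Period five: since sums contain only the primes \<open>2\<close> and \<open>p\<close>, the part of \<open>X\<^sub>i - X\<^sub>j\<close> prime to \<open>2 p\<close>
does not change when both indices are advanced, and as \<open>5\<close> is prime it is the same for all pairs.
Then a class with two members excludes any member in the opposite class (\<open>no_isolated_opposite\<close>), so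
opposite classes have at most two members together, which leaves room for four numbers only.

Period six: write \<open>D = 2 q P\<close> with \<open>q\<close> a power of \<open>2\<close> and \<open>P\<close> a power of \<open>p\<close>. The \<open>2\<close>-adic and
\<open>p\<close>-adic sizes of \<open>X\<^sub>i - X\<^sub>j\<close> count for how many steps the two orbits stay in the same residue class,
and those of \<open>X\<^sub>i + X\<^sub>j\<close> are determined similarly. So the cycle is described by two binary words of length
six, and every sum is \<open>\<plusminus>2 q\<^sup>k P\<^sup>l\<close> with exponents read off from the words. Among the differences of
\<open>X\<^sub>0, X\<^sub>2, X\<^sub>4\<close>, and of \<open>X\<^sub>1, X\<^sub>3, X\<^sub>5\<close>, this gives \<open>\<bar>q\<^sup>a - P\<^sup>b\<bar> = 1\<close> with \<open>a, b \<in> {1, 2}\<close>; the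
word modulo \<open>p\<close> must then be a rotation of \<open>000111\<close>, and \<open>q \<le> P + 1\<close>. The identities
\<open>(X\<^sub>i + X\<^sub>j) + (X\<^sub>k + X\<^sub>l) = (X\<^sub>i + X\<^sub>k) + (X\<^sub>j + X\<^sub>l)\<close> finally contradict each other in signs and
divisibility (\<open>no_antipodal_codes\<close>).\<close>

section \<open>Two-prime integers and squares\<close>

lemma abs_eq_two_prime_powers:
  fixes s p :: int
  assumes "s \<noteq> 0" "prime p" "p \<noteq> 2" "\<And>l. prime l \<Longrightarrow> l dvd s \<Longrightarrow> l = 2 \<or> l = p"
  shows "\<bar>s\<bar> = 2 ^ multiplicity 2 s * p ^ multiplicity p s"
proof -
  have "\<bar>s\<bar> = (\<Prod>l\<in>prime_factors s. l ^ multiplicity l s)"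
    using assms(1) by (simp add: prod_prime_factors)
  also have "\<dots> = (\<Prod>l\<in>{2, p}. l ^ multiplicity l s)"
  proof (rule prod.mono_neutral_left)
    show "prime_factors s \<subseteq> {2, p}"
      using assms(4) by (auto dest: in_prime_factors_imp_prime in_prime_factors_imp_dvd)
    show "\<forall>l\<in>{2, p} - prime_factors s. l ^ multiplicity l s = 1"
    proof
      fix l assume l: "l \<in> {2, p} - prime_factors s"
      then have "prime l"
        using assms(2) by auto
      then have "\<not> l dvd s"
        using l assms(1) by (auto simp: prime_factors_dvd)
      then show "l ^ multiplicity l s = 1"
        by (simp add: not_dvd_imp_multiplicity_0)
    qed
  qed simp
  also have "\<dots> = 2 ^ multiplicity 2 s * p ^ multiplicity p s"
    using assms(3) by simp
  finally show ?thesis .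
qed

lemma not_three_sums_two:
  fixes x y z :: int
  assumes "\<bar>x + y\<bar> = 2" "\<bar>y + z\<bar> = 2" "\<bar>x + z\<bar> = 2"
  shows "x = y \<or> y = z \<or> x = z"
  using assms by linarith

lemma coprime_if_no_common_prime:
  fixes a b :: int
  assumes "a \<noteq> 0" "\<And>l. prime l \<Longrightarrow> l dvd a \<Longrightarrow> l dvd b \<Longrightarrow> False"
  shows "coprime a b"
proof (rule ccontr)
  assume "\<not> coprime a b"
  then have "gcd a b \<noteq> 1"
    by (simp add: coprime_iff_gcd_eq_1)
  then have "\<not> is_unit (gcd a b)"
    by simp
  moreover have "gcd a b \<noteq> 0"
    using assms(1) by simp
  ultimately obtain l where "prime l" "l dvd gcd a b"
    by (meson prime_divisor_exists)
  then show False
    using assms(2) by auto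
qed

lemma coprime_square_factor:
  fixes a b z :: int
  assumes "coprime a b" "a * b = z\<^sup>2"
  shows "\<exists>w. \<bar>a\<bar> = w\<^sup>2"
proof -
  have "nat \<bar>a\<bar> * nat \<bar>b\<bar> = (nat \<bar>z\<bar>)\<^sup>2"
    using arg_cong[OF assms(2), of "\<lambda>x. nat \<bar>x\<bar>"]
    by (simp add: abs_mult nat_mult_distrib flip: nat_power_eq)
  moreover have "coprime (nat \<bar>a\<bar>) (nat \<bar>b\<bar>)"
    using assms(1) by (simp add: coprime_int_iff[symmetric])
  ultimately have "is_nth_power 2 (nat \<bar>a\<bar>)"
    using is_nth_power_mult_coprime_nat_iff[of "nat \<bar>a\<bar>" "nat \<bar>b\<bar>" 2]
      is_nth_powerI[of "nat \<bar>a\<bar> * nat \<bar>b\<bar>" "nat \<bar>z\<bar>" 2] by simp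
  then obtain w where "nat \<bar>a\<bar> = w ^ 2"
    by (elim is_nth_powerE)
  then have "\<bar>a\<bar> = (int w)\<^sup>2"
    by (metis abs_ge_zero int_nat_eq of_nat_power)
  then show ?thesis
    by blast
qed

lemma square_diff_one_not_square:
  fixes g w :: int
  assumes "g \<ge> 2"
  shows "g\<^sup>2 - 1 \<noteq> w\<^sup>2"
proof
  assume eq: "g\<^sup>2 - 1 = w\<^sup>2"
  have "\<bar>w\<bar> < g"
  proof (rule power2_less_imp_less)
    show "\<bar>w\<bar>\<^sup>2 < g\<^sup>2"
      unfolding power2_abs using eq by linarith
  qed (use assms in simp)
  then have "\<bar>w\<bar> \<le> g - 1"
    by simp
  then have "w\<^sup>2 \<le> (g - 1)\<^sup>2"
    using power_mono[of "\<bar>w\<bar>" "g - 1" 2] by simp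
  then show False
    using eq assms by (simp add: power2_eq_square algebra_simps)
qed

lemma prime_power_divisor:
  fixes a l :: int
  assumes "prime l" "a dvd l ^ k" "0 < a"
  obtains m where "a = l ^ m"
  using divides_primepow[OF assms(1,2)] assms(3) by (metis abs_of_pos normalize_int_def)

text \<open>From \<open>4\<^sup>x + p\<^sup>2\<^sup>y = W\<^sup>2\<close> the coprime factors \<open>W \<plusminus> 2\<^sup>x\<close> are powers of \<open>p\<close>, so the smaller is \<open>1\<close> and
\<open>(p\<^sup>y - 1) (p\<^sup>y + 1)\<close> is a power of two. This leaves only \<open>4\<^sup>2 + 3\<^sup>2 = 5\<^sup>2\<close>, and \<open>4\<^sup>2 - 3\<^sup>2\<close> is no square.\<close>

lemma power_of_two_pythagoras:
  fixes p w v :: int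
  assumes p: "prime p" "odd p" and y: "y \<ge> 1"
    and sum: "(2 ^ x)\<^sup>2 + (p ^ y)\<^sup>2 = w\<^sup>2" and diff: "\<bar>(2 ^ x)\<^sup>2 - (p ^ y)\<^sup>2\<bar> = v\<^sup>2"
  shows False
proof -
  define W where "W = \<bar>w\<bar>"
  have "W\<^sup>2 = w\<^sup>2"
    by (simp add: W_def)
  then have "(W - 2 ^ x) * (W + 2 ^ x) = (p ^ y)\<^sup>2"
    using sum by (simp add: algebra_simps power2_eq_square)
  then have W: "(W - 2 ^ x) * (W + 2 ^ x) = p ^ (y * 2)"
    by (simp add: power_mult)
  have p3: "p \<ge> 3"
    using p prime_ge_2_int[of p] by (cases "p = 2") auto
  have pos': "W + 2 ^ x > 0"
    by (simp add: W_def add_nonneg_pos)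
  moreover have "p ^ (y * 2) > 0"
    using p3 by simp
  ultimately have pos: "W - 2 ^ x > 0"
    using W by (metis zero_less_mult_pos2)
  obtain a where a: "W - 2 ^ x = p ^ a"
    using prime_power_divisor[OF p(1) _ pos] W by (metis dvd_triv_left)
  obtain b where b: "W + 2 ^ x = p ^ b"
    using prime_power_divisor[OF p(1) _ pos'] W by (metis dvd_triv_right)
  have "a = 0"
  proof (rule ccontr)
    assume "a \<noteq> 0"
    have "p ^ a < p ^ b"
      using a b by (smt (verit) zero_less_power)
    then have "b \<noteq> 0"
      using p3 one_le_power[of p a] by (metis linorder_not_less one_le_numeral order_trans power_0)
    then have "p dvd p ^ b - p ^ a"
      using \<open>a \<noteq> 0\<close> by (intro dvd_diff dvd_power) auto
    then have "p dvd (W + 2 ^ x) - (W - 2 ^ x)"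
      unfolding a b .
    then have "p dvd 2 ^ Suc x"
      by simp
    then have "p dvd 2"
      using p(1) prime_dvd_power by blast
    then show False
      using p3 zdvd_imp_le by fastforce
  qed
  then have "W - 2 ^ x = 1" "W + 2 ^ x = 2 ^ Suc x + 1"
    using a by simp_all
  then have "p ^ (y * 2) = 2 ^ Suc x + 1"
    using W by simp
  then have PP: "p ^ y * p ^ y = 2 ^ Suc x + 1"
    by (simp only: power_mult power2_eq_square)
  have "p ^ 1 \<le> p ^ y"
    using p3 y by (intro power_increasing) auto
  then have P: "p ^ y \<ge> 3"
    using p3 by simp
  have "(p ^ y - 1) * (p ^ y + 1) = 2 ^ Suc x"
    using PP by (simp add: algebra_simps)
  then have d: "p ^ y - 1 dvd 2 ^ Suc x" "p ^ y + 1 dvd 2 ^ Suc x"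
    by (metis dvd_triv_left, metis dvd_triv_right)
  have two: "prime (2::int)"
    by simp
  obtain i where i: "p ^ y - 1 = 2 ^ i"
    using prime_power_divisor[OF two d(1)] P by auto
  obtain j where j: "p ^ y + 1 = 2 ^ j"
    using prime_power_divisor[OF two d(2)] P by auto
  have "\<not> i \<ge> 2"
  proof
    assume "i \<ge> 2"
    then have "(4::int) dvd 2 ^ i"
      using le_imp_power_dvd[of 2 i "2::int"] by simp
    moreover have "j \<ge> i"
    proof -
      have "(2::int) ^ i \<le> 2 ^ j"
        using i j by linarith
      then show ?thesis
        by simp
    qed
    then have "(4::int) dvd 2 ^ j"
      using le_imp_power_dvd[of 2 j "2::int"] \<open>i \<ge> 2\<close> by simp
    ultimately have "4 dvd (2::int) ^ j - 2 ^ i"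
      by simp
    moreover have "(2::int) ^ j - 2 ^ i = 2"
      using i j by linarith
    ultimately show False
      by simp
  qed
  moreover have "i \<noteq> 0"
    using i P by (intro notI) simp
  ultimately have "i = 1"
    by simp
  then have p_y: "p ^ y = 3"
    using i by simp
  then have "2 ^ Suc x = (2::int) ^ 3"
    using PP by simp
  then have "x = 2"
    using power_inject_exp[of "2::int" "Suc x" 3] by simp
  then have v: "v\<^sup>2 = 7"
    using diff p_y by simp
  have "\<bar>v\<bar> < 3"
  proof (rule power2_less_imp_less)
    show "\<bar>v\<bar>\<^sup>2 < 3\<^sup>2"
      unfolding power2_abs v by simp
  qed simp
  then have "v \<in> {-2,-1,0,1,2}"
    by auto
  then show False
    using v by auto
qed

text \<open>The curve \<open>z\<^sup>2 = (1 + a\<^sup>2) (1 - a\<^sup>2) (1 - 2 a - a\<^sup>2)\<close> parametrizes cycles of period four. At \<open>a = m / k\<close> its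
three factors share no odd prime. Hence \<open>\<bar>k\<^sup>2 - m\<^sup>2\<bar>\<close> is a square, and so is \<open>k\<^sup>2 + m\<^sup>2\<close> when \<open>m\<close> and \<open>k\<close>
have different parity. If one of \<open>m\<close>, \<open>k\<close> is \<open>\<plusminus>1\<close>, the first square is a square minus one; otherwise
one of them is a power of two, the other a power of \<open>p\<close>, and the previous lemma applies.\<close>

lemma two_prime_units_not_on_curve:
  fixes p m k z :: int
  assumes p: "prime p" "odd p" and cop: "coprime m k"
    and nz: "m \<noteq> 0" "k \<noteq> 0" "m\<^sup>2 \<noteq> k\<^sup>2"
    and units: "\<And>l. prime l \<Longrightarrow> l dvd m * k \<Longrightarrow> l = 2 \<or> l = p"
    and square: "(k\<^sup>2 + m\<^sup>2) * (k\<^sup>2 - m\<^sup>2) * (k\<^sup>2 - 2 * k * m - m\<^sup>2) = z\<^sup>2"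
  shows False
proof -
  define a b c where "a = k\<^sup>2 + m\<^sup>2" and "b = k\<^sup>2 - m\<^sup>2" and "c = k\<^sup>2 - 2 * k * m - m\<^sup>2"
  have eq: "a * b * c = z\<^sup>2"
    using square by (simp add: a_def b_def c_def)
  have b0: "b \<noteq> 0" and a0: "a \<noteq> 0"
    using nz by (auto simp: a_def b_def sum_power2_eq_zero_iff)
  \<comment> \<open>An odd prime dividing two of the factors divides both \<open>m\<close> and \<open>k\<close>.\<close>
  have both: False if "prime l" "l dvd m" "l dvd k" for l
    using that cop by (meson coprime_common_divisor not_prime_unit)
  have l2: "l dvd x" if "prime l" "odd l" "l dvd 2 * x" for l x :: int
  proof -
    have "\<not> l dvd 2"
      using that(1,2) primes_dvd_imp_eq[of l 2] by auto
    then show ?thesis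
      using that(1,3) prime_dvd_mult_iff by blast
  qed
  have ab: False if l: "prime l" "odd l" "l dvd a" "l dvd b" for l
  proof -
    have "l dvd a + b" "l dvd a - b"
      using l by auto
    then have "l dvd 2 * k\<^sup>2" "l dvd 2 * m\<^sup>2"
      by (simp_all add: a_def b_def)
    then show False
      using l2 l(1,2) both by (meson prime_dvd_power)
  qed
  have bc: False if l: "prime l" "odd l" "l dvd b" "l dvd c" for l
  proof -
    have "l dvd b - c"
      using l by auto
    then have "l dvd 2 * (k * m)"
      by (simp add: b_def c_def mult.assoc)
    then have "l dvd k \<or> l dvd m"
      using l2 l(1,2) prime_dvd_mult_iff by blast
    moreover have "l dvd k\<^sup>2 - m\<^sup>2"
      using l(3) by (simp add: b_def)
    ultimately have "l dvd k \<and> l dvd m"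
      by (metis diff_0_right dvd_diff_right_iff dvd_diff_left_iff dvd_power_same[of l _ 2] l(1) power2_eq_square prime_dvd_multD dvd_mult)
    then show False
      using both l(1) by blast
  qed
  have ac: False if l: "prime l" "odd l" "l dvd a" "l dvd c" for l
  proof -
    have "l dvd a + c"
      using l by auto
    then have "l dvd 2 * (k * (k - m))"
      by (simp add: a_def c_def algebra_simps power2_eq_square)
    then have "l dvd k \<or> l dvd k - m"
      using l2 l(1,2) prime_dvd_mult_iff by blast
    then show False
    proof
      assume "l dvd k"
      then have "l dvd m\<^sup>2"
        using l(3) by (simp add: a_def dvd_add_right_iff power2_eq_square)
      then show False
        using both[OF l(1) _ \<open>l dvd k\<close>] l(1) prime_dvd_power by blast
    next
      assume "l dvd k - m"
      then have "l dvd a - (k - m) * (k + m)"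
        using l(3) by auto
      then have "l dvd 2 * m\<^sup>2"
        by (simp add: a_def algebra_simps power2_eq_square)
      then have "l dvd m"
        using l2 l(1,2) by (meson prime_dvd_power)
      then have "l dvd (k - m) + m"
        using \<open>l dvd k - m\<close> by (intro dvd_add)
      then show False
        using both \<open>l dvd m\<close> l(1) by simp
    qed
  qed
  have odd_or: "odd m \<or> odd k"
    using both[of 2] by auto
  \<comment> \<open>Hence \<open>b\<close> is a square up to sign, and so is \<open>a\<close> when \<open>m\<close> and \<open>k\<close> have opposite parity.\<close>
  have "\<exists>w. \<bar>b\<bar> = w\<^sup>2"
  proof (cases "odd m \<and> odd k")
    case True
    then obtain m' k' where mk: "m = 2 * m' + 1" "k = 2 * k' + 1"
      by (meson oddE)
    define a' c' where "a' = 2 * (k' * k' + k' + m' * m' + m') + 1"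
      and "c' = 2 * (k' * k' - m' * m' - 2 * k' * m' - 2 * m') - 1"
    have a': "a = 2 * a'" and c': "c = 2 * c'"
      by (simp_all add: a_def c_def a'_def c'_def mk algebra_simps power2_eq_square)
    have "odd a'" "odd c'"
      by (simp_all add: a'_def c'_def)
    have "coprime b (a' * c')"
    proof (rule coprime_if_no_common_prime[OF b0])
      fix l assume l: "prime l" "l dvd b" "l dvd a' * c'"
      then have "l dvd a' \<or> l dvd c'"
        by (simp add: prime_dvd_mult_iff)
      moreover from this have "odd l"
        using \<open>odd a'\<close> \<open>odd c'\<close> by (meson dvd_trans)
      ultimately show False
        using ab bc l a' c' by (meson dvd_mult)
    qed
    moreover have "even z"
      using eq a' by (metis dvd_mult2 dvd_triv_left even_power)
    then obtain z' where "z = 2 * z'" ..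
    then have "b * (a' * c') = z'\<^sup>2"
      using eq a' c' by (simp add: algebra_simps power2_eq_square)
    ultimately show ?thesis
      by (rule coprime_square_factor)
  next
    case False
    then have odds: "odd a" "odd b" "odd c"
      using odd_or by (auto simp: a_def b_def c_def)
    have "coprime b (a * c)"
    proof (rule coprime_if_no_common_prime[OF b0])
      fix l assume l: "prime l" "l dvd b" "l dvd a * c"
      then have "odd l"
        using odds by (meson dvd_trans)
      then show False
        using ab bc l by (auto simp: prime_dvd_mult_iff)
    qed
    moreover have "b * (a * c) = z\<^sup>2"
      using eq by (simp add: algebra_simps)
    ultimately show ?thesis
      by (rule coprime_square_factor)
  qed
  then obtain v where v: "\<bar>b\<bar> = v\<^sup>2"
    by blast
  have sum_square: "\<exists>w. a = w\<^sup>2" if "even m \<or> even k"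
  proof -
    have odds: "odd a" "odd b" "odd c"
      using odd_or that by (auto simp: a_def b_def c_def)
    have "coprime a (b * c)"
    proof (rule coprime_if_no_common_prime[OF a0])
      fix l assume l: "prime l" "l dvd a" "l dvd b * c"
      then have "odd l"
        using odds by (meson dvd_trans)
      then show False
        using ab ac l by (auto simp: prime_dvd_mult_iff)
    qed
    moreover have "a * (b * c) = z\<^sup>2"
      using eq by (simp add: algebra_simps)
    ultimately have "\<exists>w. \<bar>a\<bar> = w\<^sup>2"
      by (rule coprime_square_factor)
    moreover have "a \<ge> 0"
      by (simp add: a_def)
    ultimately show ?thesis
      by simp
  qed
  have not_unit: False if "\<bar>g\<bar> = 1" "\<bar>b\<bar> = \<bar>h\<^sup>2 - g\<^sup>2\<bar>" "h \<noteq> 0" "h\<^sup>2 \<noteq> g\<^sup>2" for g h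
  proof -
    have g: "g\<^sup>2 = 1"
      using that(1) by (metis one_power2 power2_abs)
    have h: "\<bar>h\<bar> \<ge> 2"
    proof (rule ccontr)
      assume "\<not> \<bar>h\<bar> \<ge> 2"
      then have "\<bar>h\<bar> = 1"
        using that(3) by linarith
      then show False
        using that(4) g by (metis one_power2 power2_abs)
    qed
    then have "2\<^sup>2 \<le> \<bar>h\<bar>\<^sup>2"
      by (intro power_mono) auto
    then have "\<bar>h\<bar>\<^sup>2 - 1 = v\<^sup>2"
      using v that(2) g by simp
    then show False
      using square_diff_one_not_square[OF h] by blast
  qed
  have only: "l = 2 \<or> l = p" if "prime l" "l dvd m \<or> l dvd k" for l
    using units[OF that(1)] that(2) by (meson dvd_mult dvd_mult2)
  have p2: "p \<noteq> 2"
    using p(2) by auto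
  have M: "\<bar>m\<bar> = 2 ^ multiplicity 2 m * p ^ multiplicity p m"
    using abs_eq_two_prime_powers[OF nz(1) p(1) p2] only by blast
  have K: "\<bar>k\<bar> = 2 ^ multiplicity 2 k * p ^ multiplicity p k"
    using abs_eq_two_prime_powers[OF nz(2) p(1) p2] only by blast
  have main: False
    if g: "\<bar>g\<bar> = 2 ^ x" and h: "\<bar>h\<bar> = p ^ y" and "y \<noteq> 0"
      and a: "a = g\<^sup>2 + h\<^sup>2" and b: "\<bar>b\<bar> = \<bar>g\<^sup>2 - h\<^sup>2\<bar>" and par: "even m \<or> even k" for g h x y
  proof -
    have gh: "g\<^sup>2 = (2 ^ x)\<^sup>2" "h\<^sup>2 = (p ^ y)\<^sup>2"
      using g h by (metis power2_abs)+
    obtain w where "a = w\<^sup>2"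
      using sum_square[OF par] by blast
    then have "(2 ^ x)\<^sup>2 + (p ^ y)\<^sup>2 = w\<^sup>2" "\<bar>(2 ^ x)\<^sup>2 - (p ^ y)\<^sup>2\<bar> = v\<^sup>2"
      using a b v unfolding gh by metis+
    moreover have "1 \<le> y"
      using \<open>y \<noteq> 0\<close> by simp
    ultimately show False
      using power_of_two_pythagoras[OF p] by blast
  qed
  have m2: "multiplicity l m = 0 \<or> multiplicity l k = 0" if "prime l" for l
    using both[OF that] by (meson not_dvd_imp_multiplicity_0)
  have ab_sym: "a = m\<^sup>2 + k\<^sup>2" "a = k\<^sup>2 + m\<^sup>2" "\<bar>b\<bar> = \<bar>m\<^sup>2 - k\<^sup>2\<bar>" "\<bar>b\<bar> = \<bar>k\<^sup>2 - m\<^sup>2\<bar>"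
    unfolding a_def b_def by (rule add.commute refl abs_minus_commute)+
  have nm: "\<bar>m\<bar> \<noteq> 1" "\<bar>k\<bar> \<noteq> 1"
    using not_unit[OF _ ab_sym(4) nz(2)] not_unit[OF _ ab_sym(3) nz(1)] nz(3) by metis+
  have par: "even x" if "\<bar>x\<bar> = 2 ^ i" "\<bar>x\<bar> \<noteq> 1" for x :: int and i
    using that dvd_abs_iff[of 2 x] by (cases i) auto
  have "multiplicity 2 m = 0 \<or> multiplicity 2 k = 0" "multiplicity p m = 0 \<or> multiplicity p k = 0"
    using m2 p(1) by auto
  then consider "\<bar>m\<bar> = 2 ^ multiplicity 2 m" "\<bar>k\<bar> = p ^ multiplicity p k"
    | "\<bar>k\<bar> = 2 ^ multiplicity 2 k" "\<bar>m\<bar> = p ^ multiplicity p m"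
    using M K nm by (metis mult.left_neutral mult.right_neutral power_0)
  then show False
  proof cases
    case 1
    have "even m"
      using par 1(1) nm(1) by blast
    moreover have "multiplicity p k \<noteq> 0"
      using 1(2) nm(2) by (metis power_0)
    ultimately show False
      using main[OF 1 _ ab_sym(1,3)] by blast
  next
    case 2
    have "even k"
      using par 2(1) nm(2) by blast
    moreover have "multiplicity p m \<noteq> 0"
      using 2(2) nm(1) by (metis power_0)
    ultimately show False
      using main[OF 2 _ ab_sym(2,4)] by blast
  qed
qed

section \<open>Cycles of integer numerators\<close>

text \<open>A cycle of exact period \<open>n\<close> of \<open>x \<mapsto> x\<^sup>2 - A / D\<^sup>2\<close>, given by the numerators over its common denominator \<open>D\<close>.
The indices run through all natural numbers and are read modulo \<open>n\<close>.\<close>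

locale integral_cycle =
  fixes X :: "nat \<Rightarrow> int" and A D :: int and n :: nat
  assumes D_pos: "0 < D"
    and step: "D * X (Suc i) = (X i)\<^sup>2 - A"
    and coprime_D: "coprime (X i) D"
    and inj: "X i = X j \<longleftrightarrow> i mod n = j mod n"
    and n_pos: "0 < n"
begin

lemma X_add_n: "X (i + n) = X i"
  by (simp add: inj)

lemma mod_Suc_neq: "i mod n \<noteq> j mod n \<Longrightarrow> Suc i mod n \<noteq> Suc j mod n"
  using n_pos by (metis Suc_eq_plus1 cong_def cong_add_rcancel_nat)

lemma mod_neq_add: "i mod n \<noteq> j mod n \<Longrightarrow> (i + k) mod n \<noteq> (j + k) mod n"
  by (metis cong_def cong_add_rcancel_nat)

lemma diff_step: "D * (X (Suc i) - X (Suc j)) = (X i - X j) * (X i + X j)"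
  using step[of i] step[of j] by (simp add: algebra_simps power2_eq_square)

lemma diff_prod:
  "(X i - X j) * (\<Prod>k<m. X (i + k) + X (j + k)) = D ^ m * (X (i + m) - X (j + m))"
proof (induction m)
  case (Suc m)
  have "(X i - X j) * (\<Prod>k<Suc m. X (i + k) + X (j + k))
      = D ^ m * ((X (i + m) - X (j + m)) * (X (i + m) + X (j + m)))"
    unfolding prod.lessThan_Suc mult.assoc[symmetric] Suc by simp
  also have "\<dots> = D ^ Suc m * (X (i + Suc m) - X (j + Suc m))"
    using diff_step[of "i + m" "j + m"] by simp
  finally show ?case .
qed simp

text \<open>Once around the cycle the difference comes back to itself, so the product of the \<open>n\<close> sums met on the
way is \<open>D\<^sup>n\<close>.\<close>

lemma sum_dvd_power:
  assumes "i mod n \<noteq> j mod n"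
  shows "X i + X j dvd D ^ n"
proof -
  have "(X i - X j) * (\<Prod>k<n. X (i + k) + X (j + k)) = (X i - X j) * D ^ n"
    using diff_prod[of i j n] by (simp add: X_add_n)
  moreover have "X i - X j \<noteq> 0"
    using assms by (simp add: inj)
  ultimately have eq: "(\<Prod>k<n. X (i + k) + X (j + k)) = D ^ n"
    by simp
  have "X (i + 0) + X (j + 0) dvd (\<Prod>k<n. X (i + k) + X (j + k))"
    using n_pos by (intro dvd_prodI) auto
  then show ?thesis
    using eq by simp
qed

lemma prime_dvd_sum:
  assumes "i mod n \<noteq> j mod n" "prime l" "l dvd X i + X j"
  shows "l dvd D"
  using sum_dvd_power[OF assms(1)] assms(2,3) by (meson dvd_trans prime_dvd_power)

text \<open>If \<open>D\<close> were odd, the recursion modulo \<open>2\<close> would give \<open>X\<^sub>0\<close> and \<open>X\<^sub>2\<close> the same parity, and their even sum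
would divide a power of \<open>D\<close>.\<close>

lemma even_D:
  assumes "n \<ge> 3"
  shows "even D"
proof (rule ccontr)
  assume odd: "odd D"
  have "even (D * X (Suc i)) = even ((X i)\<^sup>2 - A)" for i
    using step by simp
  then have "even (X (Suc i)) \<longleftrightarrow> (even (X i) \<longleftrightarrow> even A)" for i
    using odd by simp
  then have "even (X 2 + X 0)"
    by (auto simp: numeral_2_eq_2)
  moreover have "2 mod n \<noteq> 0 mod n"
    using assms by simp
  ultimately show False
    using prime_dvd_sum[of 2 0 2] odd by auto
qed

lemma odd_X: "even D \<Longrightarrow> odd (X i)"
  using coprime_D[of i] by (metis coprime_common_divisor odd_one)

text \<open>Sums have no prime outside \<open>D\<close>, so advancing both indices preserves the part of a difference that is
prime to \<open>D\<close>. The next lemma chains such steps.\<close>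

lemma coprime_dvd_shift:
  assumes "coprime m D" "m dvd X i - X j"
  shows "m dvd X (i + k) - X (j + k)"
proof (induction k)
  case (Suc k)
  then have "m dvd D * (X (Suc (i + k)) - X (Suc (j + k)))"
    unfolding diff_step by simp
  then show ?case
    using assms(1) by (simp add: coprime_dvd_mult_right_iff)
qed (use assms in simp)

lemma coprime_dvd_multiples:
  assumes "coprime m D" "m dvd X i - X (i + d)"
  shows "m dvd X i - X (i + k * d)"
proof (induction k)
  case (Suc k)
  have "m dvd X (i + k * d) - X (i + k * d + d)"
    using coprime_dvd_shift[OF assms, of "k * d"] by (simp add: algebra_simps)
  from dvd_add[OF Suc this] show ?case
    by (simp add: algebra_simps)
qed simp

end

locale two_prime_cycle = integral_cycle +
  fixes p :: int
  assumes p: "prime p" "odd p"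
    and primes_D: "\<And>l. prime l \<Longrightarrow> l dvd D \<Longrightarrow> l = 2 \<or> l = p"
    and n_ge_3: "3 \<le> n"
begin

lemma two_dvd_D: "even D"
  using even_D n_ge_3 by blast

lemma X_odd: "odd (X i)"
  using odd_X two_dvd_D by blast

lemma p_ge_3: "3 \<le> p"
  using p prime_ge_2_int[of p] by (cases "p = 2") auto

lemma p_neq_2: "p \<noteq> 2"
  using p_ge_3 by simp

lemma not_p_dvd_two_power: "\<not> p dvd 2 ^ k"
proof
  assume "p dvd 2 ^ k"
  then have "p dvd 2"
    using p(1) prime_dvd_power by blast
  then show False
    using p_ge_3 zdvd_imp_le by fastforce
qed

lemma X_neq: "i mod n \<noteq> j mod n \<Longrightarrow> X i - X j \<noteq> 0"
  by (simp add: inj)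

lemma sum_nonzero:
  assumes "i mod n \<noteq> j mod n"
  shows "X i + X j \<noteq> 0"
  using sum_dvd_power[OF assms] D_pos by auto

lemma abs_sum:
  assumes "i mod n \<noteq> j mod n"
  shows "\<bar>X i + X j\<bar> = 2 ^ multiplicity 2 (X i + X j) * p ^ multiplicity p (X i + X j)"
  using abs_eq_two_prime_powers[OF sum_nonzero[OF assms] p(1) p_neq_2]
    prime_dvd_sum[OF assms] primes_D by blast

section \<open>No cycle of period four\<close>

text \<open>Put \<open>s = X\<^sub>0 + X\<^sub>2\<close>, \<open>t = X\<^sub>1 + X\<^sub>3\<close> and \<open>d = X\<^sub>0 - X\<^sub>2\<close>. Two steps of the map turn \<open>d\<close> into \<open>- d\<close>, so
\<open>s t = - D\<^sup>2\<close>. Eliminating \<open>t\<close> and \<open>X\<^sub>1 - X\<^sub>3 = d s / D\<close> puts \<open>s / D\<close> on the curve of \<open>two_prime_units_not_on_curve\<close>.\<close>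

lemma n_neq_4: "n \<noteq> 4"
proof
  assume n: "n = 4"
  define s t d where "s = X 0 + X 2" and "t = X 1 + X 3" and "d = X 0 - X 2"
  have ne: "0 mod n \<noteq> 2 mod n"
    using n by simp
  have "X 4 = X 0"
    using X_add_n[of 0] n by simp
  then have st: "D * (X 1 - X 3) = d * s" "D * - d = (X 1 - X 3) * t"
    using diff_step[of 0 2] diff_step[of 1 3]
    by (simp_all add: s_def t_def d_def eval_nat_numeral)
  have d0: "d \<noteq> 0"
    using X_neq[OF ne] by (simp add: d_def)
  have "D * (D * - d) = d * s * t"
    using st by (metis mult.assoc)
  then have "d * (s * t) = d * - D\<^sup>2"
    by (simp add: algebra_simps power2_eq_square)
  then have prod: "s * t = - D\<^sup>2"
    using d0 by (metis mult_left_cancel)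
  have st_diff: "2 * D * (t - s) = s\<^sup>2 + d\<^sup>2 - t\<^sup>2 - (X 1 - X 3)\<^sup>2"
    using step[of 0] step[of 1] step[of 2] step[of 3] \<open>X 4 = X 0\<close>
    by (simp add: s_def t_def d_def eval_nat_numeral algebra_simps)
  have s0: "s \<noteq> 0"
    using sum_nonzero[OF ne] by (simp add: s_def)
  have curve: "(d * s * (D\<^sup>2 - s\<^sup>2))\<^sup>2 = D\<^sup>2 * ((D\<^sup>2 + s\<^sup>2) * (D\<^sup>2 - s\<^sup>2) * (D\<^sup>2 - 2 * D * s - s\<^sup>2))"
  proof -
    define e where "e = X 1 - X 3"
    have a: "D * e = d * s" and b: "2 * D * (t - s) = s\<^sup>2 + d\<^sup>2 - t\<^sup>2 - e\<^sup>2"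
      using st st_diff by (simp_all add: e_def)
    have "D\<^sup>2 * s\<^sup>2 * (2 * D * (t - s)) = D\<^sup>2 * s\<^sup>2 * (s\<^sup>2 + d\<^sup>2 - t\<^sup>2 - e\<^sup>2)"
      by (simp only: b)
    then have "D\<^sup>2 * (2 * D * s * (s * t) - 2 * D * s\<^sup>2 * s)
        = D\<^sup>2 * s\<^sup>2 * s\<^sup>2 + D\<^sup>2 * s\<^sup>2 * d\<^sup>2 - D\<^sup>2 * (s * t)\<^sup>2 - s\<^sup>2 * (D * e)\<^sup>2"
      by (simp add: algebra_simps power2_eq_square)
    then have "D\<^sup>2 * (2 * D * s * (- D\<^sup>2) - 2 * D * s\<^sup>2 * s)
        = D\<^sup>2 * s\<^sup>2 * s\<^sup>2 + D\<^sup>2 * s\<^sup>2 * d\<^sup>2 - D\<^sup>2 * (- D\<^sup>2)\<^sup>2 - s\<^sup>2 * (d * s)\<^sup>2"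
      by (simp only: a prod)
    then have "d\<^sup>2 * s\<^sup>2 * (D\<^sup>2 - s\<^sup>2) = D\<^sup>2 * ((D\<^sup>2 + s\<^sup>2) * (D\<^sup>2 - 2 * D * s - s\<^sup>2))"
      by (simp add: algebra_simps power2_eq_square)
    then have "d\<^sup>2 * s\<^sup>2 * (D\<^sup>2 - s\<^sup>2) * (D\<^sup>2 - s\<^sup>2)
        = D\<^sup>2 * ((D\<^sup>2 + s\<^sup>2) * (D\<^sup>2 - 2 * D * s - s\<^sup>2)) * (D\<^sup>2 - s\<^sup>2)"
      by simp
    then show ?thesis
      by (simp add: power_mult_distrib power2_eq_square[of "D\<^sup>2 - s\<^sup>2"] mult_ac)
  qed
  have ne': "s\<^sup>2 \<noteq> D\<^sup>2"
  proof
    assume eq: "s\<^sup>2 = D\<^sup>2"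
    have "(D * (X 1 - X 3))\<^sup>2 = (d * s)\<^sup>2"
      using st by simp
    then have "D\<^sup>2 * (X 1 - X 3)\<^sup>2 = D\<^sup>2 * d\<^sup>2"
      by (simp add: power_mult_distrib eq mult.commute)
    then have e: "(X 1 - X 3)\<^sup>2 = d\<^sup>2"
      using D_pos by simp
    have "s * t = s * - s"
      using prod eq by (simp add: power2_eq_square)
    then have t: "t = - s"
      using s0 by (metis mult_left_cancel)
    then have "2 * D * (- s - s) = 0"
      using st_diff e by simp
    then show False
      using s0 D_pos by simp
  qed
  define g where "g = gcd s D"
  have g: "g > 0" "g \<noteq> 0"
    using s0 by (auto simp: g_def)
  obtain m k where m: "s = g * m" and k: "D = g * k" and cop: "coprime m k"
    using gcd_coprime_exists[of s D] g unfolding g_def[symmetric]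
    by (metis mult.commute)
  have "D\<^sup>2 * ((D\<^sup>2 + s\<^sup>2) * (D\<^sup>2 - s\<^sup>2) * (D\<^sup>2 - 2 * D * s - s\<^sup>2))
      = (D * g ^ 3)\<^sup>2 * ((k\<^sup>2 + m\<^sup>2) * (k\<^sup>2 - m\<^sup>2) * (k\<^sup>2 - 2 * k * m - m\<^sup>2))"
    by (simp add: m k algebra_simps power2_eq_square power3_eq_cube)
  with curve have sq: "(d * s * (D\<^sup>2 - s\<^sup>2))\<^sup>2
      = (D * g ^ 3)\<^sup>2 * ((k\<^sup>2 + m\<^sup>2) * (k\<^sup>2 - m\<^sup>2) * (k\<^sup>2 - 2 * k * m - m\<^sup>2))"
    by simp
  then have "(D * g ^ 3)\<^sup>2 dvd (d * s * (D\<^sup>2 - s\<^sup>2))\<^sup>2"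
    by simp
  then have "D * g ^ 3 dvd d * s * (D\<^sup>2 - s\<^sup>2)"
    by simp
  then obtain z where z: "d * s * (D\<^sup>2 - s\<^sup>2) = D * g ^ 3 * z" ..
  have "(D * g ^ 3)\<^sup>2 \<noteq> 0"
    using D_pos g by simp
  then have "(k\<^sup>2 + m\<^sup>2) * (k\<^sup>2 - m\<^sup>2) * (k\<^sup>2 - 2 * k * m - m\<^sup>2) = z\<^sup>2"
    using sq unfolding z power_mult_distrib[of _ z] by (metis mult_left_cancel)
  moreover have "m \<noteq> 0" "k \<noteq> 0"
    using m k s0 D_pos by auto
  moreover have "m\<^sup>2 \<noteq> k\<^sup>2"
    using ne' m k by (auto simp: power_mult_distrib)
  moreover have "l = 2 \<or> l = p" if "prime l" "l dvd m * k" for l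
  proof -
    have "l dvd s \<or> l dvd D"
      using that m k by (auto simp: prime_dvd_mult_iff)
    then show ?thesis
      using prime_dvd_sum[OF ne that(1)] primes_D that(1) by (auto simp: s_def)
  qed
  ultimately show False
    using two_prime_units_not_on_curve[OF p cop] by blast
qed

section \<open>Residue classes\<close>

text \<open>The two residue classes modulo \<open>4\<close> and, for \<open>p\<close> dividing \<open>D\<close>, the two classes modulo \<open>p\<close>: all \<open>X\<^sub>i\<^sup>2\<close>
are congruent to \<open>A\<close>, so \<open>X\<^sub>i \<equiv> \<plusminus>X\<^sub>0\<close>.\<close>

definition u :: "nat \<Rightarrow> bool" where
  "u i \<longleftrightarrow> X i mod 4 = 1"

definition w :: "nat \<Rightarrow> bool" where
  "w i \<longleftrightarrow> p dvd X i - X 0"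

lemma u_eq: "u i = u j \<Longrightarrow> \<not> 4 dvd X i + X j"
  and u_neq: "u i \<noteq> u j \<Longrightarrow> 4 dvd X i + X j" "u i \<noteq> u j \<Longrightarrow> \<not> 4 dvd X i - X j"
  using X_odd[of i] X_odd[of j] unfolding u_def by presburger+

lemma p_not_dvd_X: "p dvd D \<Longrightarrow> \<not> p dvd X i"
  using coprime_D[of i] p(1) by (meson coprime_common_divisor not_prime_unit)

lemma p_dvd_diff_or_sum: "p dvd D \<Longrightarrow> p dvd X i - X j \<or> p dvd X i + X j"
  using diff_step[of i j] p(1) by (metis dvd_mult2 prime_dvd_mult_iff)

lemma not_p_dvd_diff_and_sum:
  assumes "p dvd D" "p dvd X i - X j"
  shows "\<not> p dvd X i + X j"
proof
  assume "p dvd X i + X j"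
  then have "p dvd (X i + X j) + (X i - X j)"
    using assms(2) by (rule dvd_add)
  then have "p dvd 2 * X i"
    by simp
  then show False
    using p_not_dvd_X[OF assms(1)] p(1) not_p_dvd_two_power[of 1] by (simp add: prime_dvd_mult_iff)
qed

lemma w_eq_iff:
  assumes "p dvd D"
  shows "w i = w j \<longleftrightarrow> p dvd X i - X j"
proof -
  have eq: "X i - X j = (X i - X 0) - (X j - X 0)" "X i - X j = (X i + X 0) - (X j + X 0)"
    by simp_all
  have "p dvd X i - X j" if "w i" "w j"
    using that unfolding w_def by (subst eq(1)) (rule dvd_diff)
  moreover have "p dvd X i - X j" if "\<not> w i" "\<not> w j"
    using that p_dvd_diff_or_sum[OF assms] unfolding w_def by (subst eq(2)) (meson dvd_diff)
  moreover have "w i = w j" if "p dvd X i - X j"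
    using that unfolding w_def eq(1) by (metis add_diff_cancel_left' diff_add_cancel dvd_add_right_iff dvd_diff_commute dvd_add)
  ultimately show ?thesis
    by blast
qed

text \<open>Two odd numbers with the same residue modulo \<open>4\<close> have a sum that is \<open>2\<close> modulo \<open>4\<close>, and \<open>2\<close> and \<open>p\<close> are the
only primes that could divide it.\<close>

lemma abs_sum_eq_2:
  assumes "i mod n \<noteq> j mod n" "u i = u j" "\<not> p dvd X i + X j"
  shows "\<bar>X i + X j\<bar> = 2"
proof -
  let ?S = "X i + X j"
  have "multiplicity p ?S = 0"
    using assms(3) by (rule not_dvd_imp_multiplicity_0)
  moreover have "multiplicity 2 ?S = 1"
  proof (rule multiplicity_eqI)
    show "2 ^ 1 dvd ?S"
      using X_odd[of i] X_odd[of j] by simp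
    show "\<not> 2 ^ Suc 1 dvd ?S"
      using u_eq[OF assms(2)] by simp
  qed
  ultimately show ?thesis
    using abs_sum[OF assms(1)] by simp
qed

lemma no_three_in_class:
  assumes "distinct [i mod n, j mod n, k mod n]" "u i = u j" "u i = u k"
    "\<not> p dvd X i + X j" "\<not> p dvd X i + X k" "\<not> p dvd X j + X k"
  shows False
proof -
  have "\<bar>X i + X j\<bar> = 2" "\<bar>X j + X k\<bar> = 2" "\<bar>X i + X k\<bar> = 2"
    using assms by (auto intro!: abs_sum_eq_2)
  from not_three_sums_two[OF this] show False
    using assms(1) by (auto simp: inj)
qed

end

lemma card_le_2I:
  assumes "finite A" "\<And>i j k. i \<in> A \<Longrightarrow> j \<in> A \<Longrightarrow> k \<in> A \<Longrightarrow> distinct [i, j, k] \<Longrightarrow> False"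
  shows "card A \<le> 2"
proof (rule ccontr)
  assume "\<not> card A \<le> 2"
  then obtain B where B: "B \<subseteq> A" "card B = 3"
    using obtain_subset_with_card_n[of 3 A] by auto
  then obtain i j k where "B = {i, j, k}" "i \<noteq> j" "j \<noteq> k" "i \<noteq> k"
    by (auto simp: card_3_iff)
  then show False
    using assms(2)[of i j k] B(1) by auto
qed

lemma card_split:
  "card {i \<in> {..<n::nat}. P i = True} + card {i \<in> {..<n}. P i = False} = n"
proof -
  have "{i \<in> {..<n}. P i = True} \<union> {i \<in> {..<n}. P i = False} = {..<n}"
    by auto
  moreover have "card ({i \<in> {..<n}. P i = True} \<union> {i \<in> {..<n}. P i = False})
      = card {i \<in> {..<n}. P i = True} + card {i \<in> {..<n}. P i = False}"
    by (rule card_Un_disjoint) auto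
  ultimately show ?thesis
    by simp
qed

text \<open>Modulo \<open>8\<close> one of \<open>s\<close>, \<open>t\<close> is \<open>\<plusminus>4\<close>, and the sign \<open>4 e\<close> would make the other one zero. This describes
the sums across two classes that agree modulo \<open>p\<close> and differ modulo \<open>4\<close>.\<close>

lemma two_prime_power_sums:
  fixes s t e :: int
  assumes "\<bar>s\<bar> = 2 ^ x" "\<bar>t\<bar> = 2 ^ y" "4 dvd s" "4 dvd t" "s + t = 4 * e" "\<bar>e\<bar> = 1"
  shows "s = - (4 * e) \<or> t = - (4 * e)"
proof -
  have le: "2 \<le> z" if "4 dvd r" "\<bar>r\<bar> = 2 ^ z" for r :: int and z
  proof -
    have dvd: "(4::int) dvd 2 ^ z"
      using that by (metis dvd_abs_iff)
    show ?thesis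
    proof (rule ccontr)
      assume "\<not> 2 \<le> z"
      then have "z = 0 \<or> z = 1"
        by auto
      then show False
        using dvd by auto
    qed
  qed
  have x: "2 \<le> x" and y: "2 \<le> y"
    using le assms by auto
  have eight: "8 dvd r" if "3 \<le> z" "\<bar>r\<bar> = 2 ^ z" for r :: int and z
    using le_imp_power_dvd[OF that(1), of "2::int"] that(2)
    by (simp flip: dvd_abs_iff[of _ r])
  have "\<not> (3 \<le> x \<and> 3 \<le> y)"
  proof
    assume "3 \<le> x \<and> 3 \<le> y"
    then have "8 dvd s + t"
      using eight assms(1,2) by (intro dvd_add) auto
    then show False
      using assms(5,6) by presburger
  qed
  then have "x = 2 \<or> y = 2"
    using x y by linarith
  then have "\<bar>s\<bar> = 4 \<or> \<bar>t\<bar> = 4"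
    using assms(1,2) by auto
  moreover have "s \<noteq> 0" "t \<noteq> 0"
    using assms(1,2) by auto
  ultimately show ?thesis
    using assms(5,6) by linarith
qed

context two_prime_cycle
begin

text \<open>Otherwise all sums are powers of two, each class modulo \<open>4\<close> has at most two members, and \<open>n \<le> 4\<close>.\<close>

lemma p_dvd_D:
  assumes "n \<ge> 5"
  shows "p dvd D"
proof (rule ccontr)
  assume "\<not> p dvd D"
  then have np: "\<not> p dvd X i + X j" if "i mod n \<noteq> j mod n" for i j
    using prime_dvd_sum[OF that p(1)] by blast
  have "card {i \<in> {..<n}. u i = a} \<le> 2" for a
  proof (rule card_le_2I)
    fix i j k assume *: "i \<in> {i \<in> {..<n}. u i = a}" "j \<in> {i \<in> {..<n}. u i = a}"
      "k \<in> {i \<in> {..<n}. u i = a}" "distinct [i, j, k]"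
    then have "distinct [i mod n, j mod n, k mod n]"
      by auto
    then show False
      using no_three_in_class[of i j k] np * by auto
  qed simp
  from this[of True] this[of False]
  have "card {i \<in> {..<n}. u i = True} + card {i \<in> {..<n}. u i = False} \<le> 4"
    by simp
  moreover have "card {i \<in> {..<n}. u i = True} + card {i \<in> {..<n}. u i = False} = n"
    by (rule card_split)
  ultimately show False
    using assms by simp
qed

lemma no_three_same:
  assumes "n \<ge> 5" "distinct [i mod n, j mod n, k mod n]" "u i = u j" "u i = u k" "w i = w j" "w i = w k"
  shows False
proof -
  note pD = p_dvd_D[OF assms(1)]
  show False
    using no_three_in_class[OF assms(2-4)] not_p_dvd_diff_and_sum[OF pD] w_eq_iff[OF pD] assms(5,6)
    by blast
qed

text \<open>Let \<open>a, b\<close> and \<open>c, d\<close> be pairs in classes that agree modulo \<open>p\<close>. Their sums are \<open>\<plusminus>2\<close> and congruent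
modulo \<open>p\<close>, hence equal, say to \<open>2 e\<close>. The four cross sums are powers of two up to sign, divisible by
\<open>4\<close>, and add up in pairs to \<open>4 e\<close>; so each pair is \<open>8 e, - 4 e\<close>, which makes two members coincide.\<close>

lemma no_two_pairs:
  assumes n: "n \<ge> 5" and dist: "distinct [a mod n, b mod n, c mod n, d mod n]"
    and w: "w a = w b" "w a = w c" "w a = w d" and u: "u a = u b" "u c = u d"
  shows False
proof -
  note pD = p_dvd_D[OF n]
  have uac: "u a \<noteq> u c"
    using no_three_same[OF n, of a b c] dist w u by auto
  have np: "\<not> p dvd X i + X j" if "i \<in> {a, b, c, d}" "j \<in> {a, b, c, d}" for i j
  proof -
    have "w i = w j"
      using that w by blast
    then show ?thesis
      using w_eq_iff[OF pD] not_p_dvd_diff_and_sum[OF pD] by blast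
  qed
  have ab: "\<bar>X a + X b\<bar> = 2" and cd: "\<bar>X c + X d\<bar> = 2"
    using dist u np by (auto intro!: abs_sum_eq_2)
  have "p dvd (X a - X c) + (X b - X d)"
    using w w_eq_iff[OF pD, of a c] w_eq_iff[OF pD, of b d] by (intro dvd_add) auto
  then have "p dvd (X a + X b) - (X c + X d)"
    by (simp add: algebra_simps)
  moreover have "\<not> p dvd 4"
    using not_p_dvd_two_power[of 2] by simp
  moreover from this have "\<not> p dvd - 4"
    by simp
  moreover have "(X a + X b) - (X c + X d) \<in> {0, 4, -4}"
    using ab cd by auto
  ultimately have eq: "X a + X b = X c + X d"
    by force
  obtain e where e: "X a + X b = 2 * e" "X c + X d = 2 * e" "\<bar>e\<bar> = 1"
  proof -
    have "X a + X b = 2 * 1 \<or> X a + X b = 2 * - 1"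
      using ab by linarith
    then show ?thesis
      using eq by (metis that abs_1 abs_minus_cancel)
  qed
  have pow: "\<exists>x. \<bar>X i + X j\<bar> = 2 ^ x" if "i \<in> {a, b}" "j \<in> {c, d}" for i j
  proof -
    have "i mod n \<noteq> j mod n"
      using that dist by auto
    moreover have "multiplicity p (X i + X j) = 0"
      using np that by (auto intro!: not_dvd_imp_multiplicity_0)
    ultimately show ?thesis
      using abs_sum[of i j] by auto
  qed
  have four: "4 dvd X i + X j" if "i \<in> {a, b}" "j \<in> {c, d}" for i j
    using that uac u by (auto intro!: u_neq(1))
  have *: "X a + X c = - (4 * e) \<or> X b + X d = - (4 * e)"
    using pow[of a c] pow[of b d] four[of a c] four[of b d] two_prime_power_sums[of "X a + X c" _ "X b + X d" _ e] e
    by fastforce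
  have **: "X a + X d = - (4 * e) \<or> X b + X c = - (4 * e)"
    using pow[of a d] pow[of b c] four[of a d] four[of b c] two_prime_power_sums[of "X a + X d" _ "X b + X c" _ e] e
    by fastforce
  have "X a \<noteq> X b" "X c \<noteq> X d"
    using dist by (auto simp: inj)
  then show False
    using * ** e by auto
qed

definition class_of :: "bool \<Rightarrow> bool \<Rightarrow> nat set" where
  "class_of a b = {i \<in> {..<n}. u i = a \<and> w i = b}"

lemma finite_class_of [simp]: "finite (class_of a b)"
  by (simp add: class_of_def)

lemma card_class_le_2:
  assumes "n \<ge> 5"
  shows "card (class_of a b) \<le> 2"
proof (rule card_le_2I)
  fix i j k assume "i \<in> class_of a b" "j \<in> class_of a b" "k \<in> class_of a b" "distinct [i, j, k]"
  then show False
    using no_three_same[OF assms, of i j k] by (auto simp: class_of_def)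
qed simp

lemma card_w_class:
  "card {i \<in> {..<n}. w i = b} = card (class_of True b) + card (class_of False b)"
  unfolding class_of_def
  by (subst card_Un_disjoint[symmetric]) (auto intro!: arg_cong[where f = card])

lemma n_eq_card: "n = card {i \<in> {..<n}. w i = True} + card {i \<in> {..<n}. w i = False}"
  by (simp only: card_split)

lemma card_w_class_le_3:
  assumes "n \<ge> 5"
  shows "card {i \<in> {..<n}. w i = b} \<le> 3"
proof (rule ccontr)
  assume "\<not> card {i \<in> {..<n}. w i = b} \<le> 3"
  then have "card (class_of True b) = 2" "card (class_of False b) = 2"
    using card_w_class[of b] card_class_le_2[OF assms, of True b] card_class_le_2[OF assms, of False b]
    by linarith+
  then obtain i j k l where *: "class_of True b = {i, j}" "i \<noteq> j" "class_of False b = {k, l}" "k \<noteq> l"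
    by (metis card_2_iff)
  then have m: "i \<in> class_of True b" "j \<in> class_of True b" "k \<in> class_of False b" "l \<in> class_of False b"
    by auto
  then have "distinct [i mod n, j mod n, k mod n, l mod n]"
    using * by (auto simp: class_of_def)
  then show False
    using no_two_pairs[OF assms, of i j k l] m by (simp add: class_of_def)
qed

lemma n_le_6: "n \<le> 6"
  using n_eq_card card_w_class_le_3[of True] card_w_class_le_3[of False] by linarith

section \<open>No cycle of period five\<close>

lemma coprime_D_iff:
  assumes "m \<noteq> 0" "odd m" "\<not> p dvd m"
  shows "coprime m D"
  using assms primes_D by (intro coprime_if_no_common_prime) auto

text \<open>Differences between opposite classes have the form \<open>2 m\<close> with \<open>m\<close> prime to \<open>D\<close>. The hypothesis \<open>link\<close>
makes \<open>X\<^sub>i - X\<^sub>k\<close> and \<open>X\<^sub>j - X\<^sub>k\<close> equal up to sign, hence \<open>X\<^sub>i - X\<^sub>j = \<plusminus>4 m\<close>, which \<open>p\<close> does not divide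
although \<open>i\<close> and \<open>j\<close> lie in one class.\<close>

lemma no_isolated_opposite:
  assumes pD: "p dvd D" and ij: "i mod n \<noteq> j mod n" "u i = u j" "w i = w j"
    and k: "u k \<noteq> u i" "w k \<noteq> w i"
    and link: "\<And>m. coprime m D \<Longrightarrow> m dvd X i - X k \<longleftrightarrow> m dvd X j - X k"
  shows False
proof -
  have half: "\<exists>m. X l - X k = 2 * m \<and> m \<noteq> 0 \<and> odd m \<and> \<not> p dvd m"
    if "u l \<noteq> u k" "w l \<noteq> w k" for l
  proof -
    have "even (X l - X k)"
      using X_odd by simp
    then obtain m where m: "X l - X k = 2 * m" ..
    moreover have "odd m"
      using u_neq(2)[OF that(1)] m by auto
    moreover have "\<not> p dvd m"
      using w_eq_iff[OF pD, of l k] that(2) m by (metis dvd_mult)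
    ultimately show ?thesis
      by auto
  qed
  obtain m where m: "X i - X k = 2 * m" "m \<noteq> 0" "odd m" "\<not> p dvd m"
    using half[of i] k by auto
  obtain m' where m': "X j - X k = 2 * m'" "m' \<noteq> 0" "odd m'" "\<not> p dvd m'"
    using half[of j] k ij by auto
  have "m dvd 2 * m'" "m' dvd 2 * m"
    using link[OF coprime_D_iff[OF m(2-4)]] link[OF coprime_D_iff[OF m'(2-4)]] m(1) m'(1) by auto
  then have "m dvd m'" "m' dvd m"
    using m(3) m'(3) by (simp_all add: coprime_dvd_mult_right_iff)
  then have "\<bar>m\<bar> = \<bar>m'\<bar>"
    by (rule zdvd_antisym_abs)
  moreover have "X i \<noteq> X j"
    using ij by (simp add: inj)
  then have "m \<noteq> m'"
    using m(1) m'(1) by auto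
  ultimately have "m' = - m"
    by linarith
  then have "X i - X j = 2 * (2 * m)"
    using m(1) m'(1) by simp
  then have "p dvd 2 ^ 2 * m"
    using w_eq_iff[OF pD, of i j] ij by simp
  then show False
    using m(4) p(1) not_p_dvd_two_power[of 2] prime_dvd_multD by blast
qed

lemma coprime_dvd_all:
  assumes "coprime m D" "m dvd X i - X (i + d)" "coprime d n"
  shows "m dvd X a - X b"
proof -
  obtain x where x: "[d * x = 1] (mod n)"
    using cong_solve_coprime_nat[OF assms(3)] by auto
  have *: "m dvd X i - X a" for a
  proof -
    \<comment> \<open>As \<open>x\<close> inverts \<open>d\<close> modulo \<open>n\<close>, this many steps lead from \<open>i\<close> to \<open>i + a + (n - 1) i \<equiv> a\<close>.\<close>
    let ?k = "x * (a + (n - 1) * i)"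
    have "[d * x * (a + (n - 1) * i) = 1 * (a + (n - 1) * i)] (mod n)"
      using x by (rule cong_scalar_right)
    then have "[i + ?k * d = i + (a + (n - 1) * i)] (mod n)"
      by (intro cong_add) (simp_all add: mult_ac)
    moreover have "i + (a + (n - 1) * i) = a + n * i"
      using n_pos by (cases n) auto
    ultimately have "(i + ?k * d) mod n = (a + n * i) mod n"
      unfolding cong_def by metis
    then have "(i + ?k * d) mod n = a mod n"
      by simp
    then have "X (i + ?k * d) = X a"
      by (simp add: inj)
    then show ?thesis
      using coprime_dvd_multiples[OF assms(1,2), of ?k] by simp
  qed
  have "m dvd (X i - X b) - (X i - X a)"
    by (rule dvd_diff[OF *[of b] *[of a]])
  then show ?thesis
    by simp
qed

text \<open>Every nonzero step is coprime to \<open>5\<close>, so all differences have the same part prime to \<open>D\<close>. A class and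
its opposite then hold at most two members together.\<close>

lemma n_neq_5: "n \<noteq> 5"
proof
  assume n: "n = 5"
  then have n5: "n \<ge> 5"
    by simp
  note pD = p_dvd_D[OF n5]
  have all: "m dvd X a - X b" if m: "coprime m D" "m dvd X i - X j" and ij: "i mod n \<noteq> j mod n" for m i j a b
  proof -
    define d where "d = (j + n * i) - i"
    have id: "i + d = j + n * i"
      using n by (simp add: d_def)
    then have "X (i + d) = X j"
      by (simp add: inj)
    moreover have "\<not> n dvd d"
    proof
      assume "n dvd d"
      then have "(i + d) mod n = i mod n"
        by (auto elim!: dvdE)
      then show False
        using id ij by simp
    qed
    then have "coprime n d"
      using n by (intro prime_imp_coprime) simp_all
    ultimately show ?thesis
      using coprime_dvd_all[OF m(1), of i d] m(2) by (simp add: coprime_commute)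
  qed
  have bad: False if i: "i \<in> class_of a b" "j \<in> class_of a b" "i \<noteq> j" and k: "k \<in> class_of (\<not> a) (\<not> b)" for i j k a b
  proof (rule no_isolated_opposite[OF pD, of i j k])
    fix m assume "coprime m D"
    moreover have "i mod n \<noteq> k mod n" "j mod n \<noteq> k mod n"
      using i k by (auto simp: class_of_def)
    ultimately show "m dvd X i - X k \<longleftrightarrow> m dvd X j - X k"
      using all by blast
  qed (use i k in \<open>auto simp: class_of_def\<close>)
  have le: "card (class_of a b) + card (class_of (\<not> a) (\<not> b)) \<le> 2" for a b
  proof (rule ccontr)
    assume "\<not> ?thesis"
    then have "card (class_of a b) = 2 \<and> card (class_of (\<not> a) (\<not> b)) \<noteq> 0
        \<or> card (class_of (\<not> a) (\<not> b)) = 2 \<and> card (class_of a b) \<noteq> 0"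
      using card_class_le_2[OF n5, of a b] card_class_le_2[OF n5, of "\<not> a" "\<not> b"] by linarith
    then show False
    proof
      assume *: "card (class_of a b) = 2 \<and> card (class_of (\<not> a) (\<not> b)) \<noteq> 0"
      then obtain i j where "class_of a b = {i, j}" "i \<noteq> j"
        by (metis card_2_iff)
      moreover obtain k where "k \<in> class_of (\<not> a) (\<not> b)"
        using * by (metis card.empty ex_in_conv)
      ultimately show False
        using bad[of i a b j k] by auto
    next
      assume *: "card (class_of (\<not> a) (\<not> b)) = 2 \<and> card (class_of a b) \<noteq> 0"
      then obtain i j where "class_of (\<not> a) (\<not> b) = {i, j}" "i \<noteq> j"
        by (metis card_2_iff)
      moreover obtain k where "k \<in> class_of a b"
        using * by (metis card.empty ex_in_conv)
      ultimately show False
        using bad[of i "\<not> a" "\<not> b" j k] by auto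
    qed
  qed
  show False
    using le[of True True] le[of True False] n_eq_card card_w_class[of True] card_w_class[of False] n
    unfolding not_True_eq_False not_False_eq_True by linarith
qed

end

section \<open>Binary codes of period six\<close>

text \<open>Of the three depths \<open>x, y, z\<close> at which three words split pairwise, the two smaller ones are equal; the
largest exceeds them by \<open>a\<close>.\<close>

definition gap :: "nat \<Rightarrow> nat \<Rightarrow> nat \<Rightarrow> nat \<Rightarrow> bool" where
  "gap a x y z \<longleftrightarrow> x = y + a \<and> z = y \<or> y = z + a \<and> x = z \<or> z = x + a \<and> y = x"

text \<open>The exponent patterns for which a sum of two signed powers of \<open>q\<close> is small enough to be compared with \<open>P\<^sup>2\<close>.\<close>

definition near :: "nat \<Rightarrow> nat \<Rightarrow> bool" where
  "near x y \<longleftrightarrow> x \<noteq> y \<and> x \<le> y + 2 \<and> y \<le> x + 2"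

text \<open>A cyclic system of counters: \<open>x0\<close> counts how many consecutive conditions hold from its place on, and a
full round of true conditions would give \<open>x0 = x0 + 6\<close>.\<close>

lemma cyclic_recursion:
  fixes x0 x1 x2 x3 x4 x5 :: nat
  assumes "x0 = (if c0 then Suc x1 else 0)" "x1 = (if c1 then Suc x2 else 0)"
    "x2 = (if c2 then Suc x3 else 0)" "x3 = (if c3 then Suc x4 else 0)"
    "x4 = (if c4 then Suc x5 else 0)" "x5 = (if c5 then Suc x0 else 0)"
  shows "x0 = (if c0 then if c1 then if c2 then if c3 then if c4 then 5 else 4 else 3 else 2 else 1 else 0)"
    and "\<not> (c0 \<and> c1 \<and> c2 \<and> c3 \<and> c4 \<and> c5)"
proof -
  show no: "\<not> (c0 \<and> c1 \<and> c2 \<and> c3 \<and> c4 \<and> c5)"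
  proof
    assume *: "c0 \<and> c1 \<and> c2 \<and> c3 \<and> c4 \<and> c5"
    have "x0 = Suc x1"
      using * assms(1) by simp
    moreover have "x1 = Suc x2"
      using * assms(2) by simp
    moreover have "x2 = Suc x3"
      using * assms(3) by simp
    moreover have "x3 = Suc x4"
      using * assms(4) by simp
    moreover have "x4 = Suc x5"
      using * assms(5) by simp
    moreover have "x5 = Suc x0"
      using * assms(6) by simp
    ultimately show False
      by linarith
  qed
  have "c0 \<Longrightarrow> c1 \<Longrightarrow> c2 \<Longrightarrow> c3 \<Longrightarrow> c4 \<Longrightarrow> x5 = 0"
    using no assms(6) by auto
  then show "x0 = (if c0 then if c1 then if c2 then if c3 then if c4 then 5 else 4 else 3 else 2 else 1 else 0)"
    using assms(1-5) by auto
qed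

text \<open>A word \<open>v\<close> of period six together with the length \<open>e i j\<close> of the common prefix of its rotations by \<open>i\<close>
and \<open>j\<close>. The recursion forces these lengths to be finite, so \<open>v\<close> has no smaller period.\<close>

locale binary_code6 =
  fixes v :: "nat \<Rightarrow> bool" and e :: "nat \<Rightarrow> nat \<Rightarrow> nat"
  assumes periodic: "v (i + 6) = v i"
    and e_periodic: "e (i + 6) j = e i j"
    and e_sym: "e i j = e j i"
    and e_rec: "i mod 6 \<noteq> j mod 6 \<Longrightarrow> e i j = (if v i = v j then Suc (e (Suc i) (Suc j)) else 0)"
begin

text \<open>If \<open>e\<close> measures the divisibility of a difference, \<open>k\<close> measures that of the corresponding sum: the sum
matters only when the words differ at once, and then it takes over one step and the following prefix.\<close>

definition k :: "nat \<Rightarrow> nat \<Rightarrow> nat" where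
  "k i j = (if v i = v j then 0 else Suc (e (Suc i) (Suc j)))"

lemma shift: "binary_code6 (\<lambda>i. v (i + s)) (\<lambda>i j. e (i + s) (j + s))"
proof
  fix i j :: nat
  show "v (i + 6 + s) = v (i + s)"
    using periodic[of "i + s"] by (simp add: add_ac)
  show "e (i + 6 + s) (j + s) = e (i + s) (j + s)"
    using e_periodic[of "i + s"] by (simp add: add_ac)
  show "e (i + s) (j + s) = e (j + s) (i + s)"
    by (rule e_sym)
  assume "i mod 6 \<noteq> j mod 6"
  then have "(i + s) mod 6 \<noteq> (j + s) mod 6"
    using cong_add_rcancel_nat[of i s j 6] by (simp add: cong_def)
  then show "e (i + s) (j + s) = (if v (i + s) = v (j + s) then Suc (e (Suc i + s) (Suc j + s)) else 0)"
    using e_rec[of "i + s" "j + s"] by simp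
qed

lemma e_wrap: "e 6 j = e 0 j" "e j 6 = e 0 j"
  using e_periodic[of 0 j] e_sym[of j 6] by simp_all

lemma e_wrap_Suc: "e (Suc (Suc (Suc (Suc (Suc (Suc 0)))))) j = e 0 j" "e j (Suc (Suc (Suc (Suc (Suc (Suc 0)))))) = e 0 j"
  using e_wrap(1)[of j] e_wrap(2)[of j] by (simp_all add: numeral_eq_Suc)

lemma e_recI: "i mod 6 \<noteq> j mod 6 \<Longrightarrow> e (Suc i) (Suc j) = x \<Longrightarrow> e i j = (if v i = v j then Suc x else 0)"
  by (simp add: e_rec)

lemma e_dist1:
  "e 0 1 = (if v 0 = v 1 then Suc (e 1 2) else 0)" "e 1 2 = (if v 1 = v 2 then Suc (e 2 3) else 0)"
  "e 2 3 = (if v 2 = v 3 then Suc (e 3 4) else 0)" "e 3 4 = (if v 3 = v 4 then Suc (e 4 5) else 0)"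
  "e 4 5 = (if v 4 = v 5 then Suc (e 0 5) else 0)" "e 0 5 = (if v 0 = v 5 then Suc (e 0 1) else 0)"
  by (rule e_recI, simp, simp add: numeral_eq_Suc e_wrap_Suc)+

lemma e_dist2:
  "e 0 2 = (if v 0 = v 2 then Suc (e 1 3) else 0)" "e 1 3 = (if v 1 = v 3 then Suc (e 2 4) else 0)"
  "e 2 4 = (if v 2 = v 4 then Suc (e 3 5) else 0)" "e 3 5 = (if v 3 = v 5 then Suc (e 0 4) else 0)"
  "e 0 4 = (if v 0 = v 4 then Suc (e 1 5) else 0)" "e 1 5 = (if v 1 = v 5 then Suc (e 0 2) else 0)"
  by (rule e_recI, simp, simp add: numeral_eq_Suc e_wrap_Suc)+

lemma e_dist3:
  "e 0 3 = (if v 0 = v 3 then Suc (e 1 4) else 0)" "e 1 4 = (if v 1 = v 4 then Suc (e 2 5) else 0)"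
  "e 2 5 = (if v 2 = v 5 then Suc (e 0 3) else 0)"
  by (rule e_recI, simp, simp add: numeral_eq_Suc e_wrap_Suc)+

text \<open>The prefix lengths as explicit functions of the six letters, for rotations at distance one, two and
three. At distance three the round of counters has length three and is run through twice.\<close>

lemmas e_closed =
  cyclic_recursion(1)[OF e_dist1(1,2,3,4,5,6)] cyclic_recursion(1)[OF e_dist1(2,3,4,5,6,1)]
  cyclic_recursion(1)[OF e_dist1(3,4,5,6,1,2)] cyclic_recursion(1)[OF e_dist1(4,5,6,1,2,3)]
  cyclic_recursion(1)[OF e_dist1(5,6,1,2,3,4)] cyclic_recursion(1)[OF e_dist1(6,1,2,3,4,5)]
  cyclic_recursion(1)[OF e_dist2(1,2,3,4,5,6)] cyclic_recursion(1)[OF e_dist2(2,3,4,5,6,1)]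
  cyclic_recursion(1)[OF e_dist2(3,4,5,6,1,2)] cyclic_recursion(1)[OF e_dist2(4,5,6,1,2,3)]
  cyclic_recursion(1)[OF e_dist2(5,6,1,2,3,4)] cyclic_recursion(1)[OF e_dist2(6,1,2,3,4,5)]
  cyclic_recursion(1)[OF e_dist3(1,2,3) e_dist3(1,2,3)] cyclic_recursion(1)[OF e_dist3(2,3,1) e_dist3(2,3,1)]
  cyclic_recursion(1)[OF e_dist3(3,1,2) e_dist3(3,1,2)]

lemmas aperiodic = cyclic_recursion(2)[OF e_dist2] cyclic_recursion(2)[OF e_dist3 e_dist3]

lemma gap_even: "gap 1 (e 0 2) (e 2 4) (e 0 4) \<or> gap 2 (e 0 2) (e 2 4) (e 0 4)"
  using aperiodic unfolding gap_def e_closed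
  by (cases "v 0"; cases "v 1"; cases "v 2"; cases "v 3"; cases "v 4"; cases "v 5"; simp)

lemma gap_odd: "gap 1 (e 1 3) (e 3 5) (e 1 5) \<or> gap 2 (e 1 3) (e 3 5) (e 1 5)"
  using aperiodic unfolding gap_def e_closed
  by (cases "v 0"; cases "v 1"; cases "v 2"; cases "v 3"; cases "v 4"; cases "v 5"; simp)

text \<open>Apart from \<open>010101\<close> and \<open>101010\<close>, which have period two, the words with three letters of each kind are the
rotations of \<open>000111\<close>, with gap one at even and odd
places, and those of \<open>001011\<close> and \<open>001101\<close>, where exactly one of the two gaps is two.\<close>

lemma balanced_cases:
  assumes "of_bool (v 0) + of_bool (v 1) + of_bool (v 2) + of_bool (v 3) + of_bool (v 4) + of_bool (v 5) = (3::nat)"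
  shows "v 0 \<noteq> v 3 \<and> v 1 \<noteq> v 4 \<and> v 2 \<noteq> v 5 \<and> gap 1 (e 0 2) (e 2 4) (e 0 4)
    \<or> gap 1 (e 0 2) (e 2 4) (e 0 4) \<and> gap 2 (e 1 3) (e 3 5) (e 1 5)
    \<or> gap 2 (e 0 2) (e 2 4) (e 0 4) \<and> gap 1 (e 1 3) (e 3 5) (e 1 5)"
  using aperiodic assms unfolding gap_def e_closed
  by (cases "v 0"; cases "v 1"; cases "v 2"; cases "v 3"; cases "v 4"; cases "v 5"; simp)

lemma k_closed:
  "k 0 2 = (if v 0 = v 2 then 0 else Suc (e 1 3))" "k 3 5 = (if v 3 = v 5 then 0 else Suc (e 0 4))"
  "k 0 3 = (if v 0 = v 3 then 0 else Suc (e 1 4))" "k 2 5 = (if v 2 = v 5 then 0 else Suc (e 0 3))"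
  "k 1 4 = (if v 1 = v 4 then 0 else Suc (e 2 5))"
  "k 0 5 = (if v 0 = v 5 then 0 else Suc (e 0 1))" "k 2 3 = (if v 2 = v 3 then 0 else Suc (e 3 4))"
  "k 0 1 = (if v 0 = v 1 then 0 else Suc (e 1 2))" "k 3 4 = (if v 3 = v 4 then 0 else Suc (e 4 5))"
  "k 1 2 = (if v 1 = v 2 then 0 else Suc (e 2 3))" "k 4 5 = (if v 4 = v 5 then 0 else Suc (e 0 5))"
  by (simp_all add: k_def numeral_eq_Suc e_wrap_Suc)

text \<open>The assumptions say that no three places carry the same letters both in \<open>v\<close> and in \<open>000111\<close>. Only the rotations of
\<open>000111\<close> by one and two places escape the first two alternatives.\<close>

lemma near_cases:
  assumes "\<not> (v 0 = v 1 \<and> v 1 = v 2)" "\<not> (v 3 = v 4 \<and> v 4 = v 5)"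
  shows "near (k 0 2) (k 3 5) \<or> near (k 0 3) (k 2 5)
    \<or> v 1 = v 2 \<and> v 2 = v 3 \<and> v 3 \<noteq> v 4 \<and> v 4 = v 5 \<and> v 5 = v 0
    \<or> v 2 = v 3 \<and> v 3 = v 4 \<and> v 4 \<noteq> v 5 \<and> v 5 = v 0 \<and> v 0 = v 1"
  using aperiodic assms unfolding near_def k_closed e_closed
  by (cases "v 0"; cases "v 1"; cases "v 2"; cases "v 3"; cases "v 4"; cases "v 5"; simp)

end

section \<open>Equations between powers of two numbers\<close>

text \<open>Dividing by the common powers leaves \<open>\<plusminus>q\<^sup>a \<plusminus> P\<^sup>b \<plusminus> 1 = 0\<close> or \<open>\<plusminus>q\<^sup>a P\<^sup>b \<plusminus> 1 \<plusminus> 1 = 0\<close>, according to whether the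
two gaps occur at different pairs or at the same pair. The latter is impossible by size.\<close>

lemma triple_gap:
  fixes q P s1 s2 s3 :: int
  assumes q: "2 \<le> q" and P: "3 \<le> P" and ab: "1 \<le> a" "1 \<le> b"
    and gaps: "gap a x1 x2 x3" "gap b y1 y2 y3"
    and s: "\<bar>s1\<bar> = 1" "\<bar>s2\<bar> = 1" "\<bar>s3\<bar> = 1"
    and sum: "s1 * q ^ x1 * P ^ y1 + s2 * q ^ x2 * P ^ y2 + s3 * q ^ x3 * P ^ y3 = 0"
  shows "\<bar>q ^ a - P ^ b\<bar> = 1"
proof -
  define Q R where "Q = q ^ a" and "R = P ^ b"
  have Q: "Q \<ge> 2" and R: "R \<ge> 3"
    using power_increasing[OF ab(1), of q] power_increasing[OF ab(2), of P] q P by (auto simp: Q_def R_def)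
  have QR: "Q * R \<ge> 6"
    using mult_mono[of 2 Q 3 R] Q R by simp
  have same: False if "t1 * (Q * R) + t2 + t3 = 0" "\<bar>t1\<bar> = 1" "\<bar>t2\<bar> = 1" "\<bar>t3\<bar> = 1" for t1 t2 t3
  proof -
    have "t1 = 1 \<or> t1 = - 1"
      using that(2) by linarith
    then show False
      using that QR by auto
  qed
  have diff: "\<bar>Q - R\<bar> = 1" if "t1 * Q + t2 * R + t3 = 0" "\<bar>t1\<bar> = 1" "\<bar>t2\<bar> = 1" "\<bar>t3\<bar> = 1" for t1 t2 t3
  proof -
    have "t1 = 1 \<or> t1 = - 1" "t2 = 1 \<or> t2 = - 1"
      using that(2,3) by linarith+
    then show ?thesis
      using that Q R by auto
  qed
  obtain h where h: "x1 = h + a \<and> x2 = h \<and> x3 = h \<or> x2 = h + a \<and> x3 = h \<and> x1 = h \<or> x3 = h + a \<and> x1 = h \<and> x2 = h"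
    using gaps(1) unfolding gap_def by metis
  obtain g where g: "y1 = g + b \<and> y2 = g \<and> y3 = g \<or> y2 = g + b \<and> y3 = g \<and> y1 = g \<or> y3 = g + b \<and> y1 = g \<and> y2 = g"
    using gaps(2) unfolding gap_def by metis
  define z where "z = q ^ h * P ^ g"
  have z: "z \<noteq> 0"
    using q P by (simp add: z_def)
  define c where "c = s1 * (q ^ (x1 - h) * P ^ (y1 - g)) + s2 * (q ^ (x2 - h) * P ^ (y2 - g)) + s3 * (q ^ (x3 - h) * P ^ (y3 - g))"
  have le: "h \<le> x1" "h \<le> x2" "h \<le> x3" "g \<le> y1" "g \<le> y2" "g \<le> y3"
    using h g by auto
  have "q ^ x * P ^ y = z * (q ^ (x - h) * P ^ (y - g))" if "h \<le> x" "g \<le> y" for x y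
    using that power_add[of q h "x - h"] power_add[of P g "y - g"] by (simp add: z_def)
  then have "z * c = s1 * (q ^ x1 * P ^ y1) + s2 * (q ^ x2 * P ^ y2) + s3 * (q ^ x3 * P ^ y3)"
    using le by (simp add: c_def algebra_simps)
  then have c: "c = 0"
    using sum z by (simp add: mult.assoc)
  from h consider "x1 = h + a" "x2 = h" "x3 = h" | "x2 = h + a" "x3 = h" "x1 = h" | "x3 = h + a" "x1 = h" "x2 = h"
    by blast
  then have "\<bar>Q - R\<bar> = 1"
  proof cases
    case 1
    note ih = this
    from g consider "y1 = g + b" "y2 = g" "y3 = g" | "y2 = g + b" "y3 = g" "y1 = g" | "y3 = g + b" "y1 = g" "y2 = g"
      by blast
    then show ?thesis
    proof cases
      case 1
      then show ?thesis
        using same[of s1 s2 s3] s c ih by (simp add: c_def Q_def R_def algebra_simps)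
    next
      case 2
      then show ?thesis
        using diff[of s1 s2 s3] s c ih by (simp add: c_def Q_def R_def algebra_simps)
    next
      case 3
      then show ?thesis
        using diff[of s1 s3 s2] s c ih by (simp add: c_def Q_def R_def algebra_simps)
    qed
  next
    case 2
    note ih = this
    from g consider "y1 = g + b" "y2 = g" "y3 = g" | "y2 = g + b" "y3 = g" "y1 = g" | "y3 = g + b" "y1 = g" "y2 = g"
      by blast
    then show ?thesis
    proof cases
      case 1
      then show ?thesis
        using diff[of s2 s1 s3] s c ih by (simp add: c_def Q_def R_def algebra_simps)
    next
      case 2
      then show ?thesis
        using same[of s2 s1 s3] s c ih by (simp add: c_def Q_def R_def algebra_simps)
    next
      case 3
      then show ?thesis
        using diff[of s2 s3 s1] s c ih by (simp add: c_def Q_def R_def algebra_simps)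
    qed
  next
    case 3
    note ih = this
    from g consider "y1 = g + b" "y2 = g" "y3 = g" | "y2 = g + b" "y3 = g" "y1 = g" | "y3 = g + b" "y1 = g" "y2 = g"
      by blast
    then show ?thesis
    proof cases
      case 1
      then show ?thesis
        using diff[of s3 s1 s2] s c ih by (simp add: c_def Q_def R_def algebra_simps)
    next
      case 2
      then show ?thesis
        using diff[of s3 s2 s1] s c ih by (simp add: c_def Q_def R_def algebra_simps)
    next
      case 3
      then show ?thesis
        using same[of s3 s1 s2] s c ih by (simp add: c_def Q_def R_def algebra_simps)
    qed
  qed
  then show ?thesis
    by (simp add: Q_def R_def)
qed

lemma consecutive_squares:
  fixes x y :: int
  assumes "\<bar>x\<^sup>2 - y\<^sup>2\<bar> = 1" "1 \<le> x" "1 \<le> y"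
  shows False
proof -
  have "False" if "a\<^sup>2 - b\<^sup>2 = 1" "1 \<le> a" "1 \<le> b" for a b :: int
  proof -
    have "b < a"
      using that by (intro power2_less_imp_less[of b a]) linarith+
    then have "(b + 1)\<^sup>2 \<le> a\<^sup>2"
      using that by (intro power_mono) auto
    then show False
      using that by (simp add: power2_eq_square algebra_simps)
  qed
  from this[of x y] this[of y x] show False
    using assms by linarith
qed

text \<open>After removing a power of \<open>q\<close>, the number \<open>P\<^sup>2\<close> would divide \<open>q\<^sup>d \<plusminus> 1\<close> with \<open>d \<in> {1, 2}\<close>. By size the
quotient is \<open>1\<close>, but \<open>q + 1 < P\<^sup>2\<close>, and \<open>P\<^sup>2\<close> and \<open>q\<^sup>2\<close> are not consecutive.\<close>

lemma square_not_dvd_power_sum: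
  fixes q P s1 s2 :: int
  assumes q: "2 \<le> q" "q \<le> P + 1" and P: "3 \<le> P" and cop: "coprime P q"
    and near: "near x y" and s: "\<bar>s1\<bar> = 1" "\<bar>s2\<bar> = 1"
  shows "\<not> P\<^sup>2 dvd s1 * q ^ x + s2 * q ^ y"
proof -
  have main: False if xy: "y = x + d" "d = 1 \<or> d = 2" and s: "\<bar>s1\<bar> = 1" "\<bar>s2\<bar> = 1"
    and dvd: "P\<^sup>2 dvd s1 * q ^ x + s2 * q ^ y" for x y d and s1 s2 :: int
  proof -
    define c where "c = s1 + s2 * q ^ d"
    have "s1 * q ^ x + s2 * q ^ y = q ^ x * c"
      by (simp add: xy(1) c_def power_add algebra_simps)
    moreover have "coprime (P\<^sup>2) (q ^ x)"
      using cop by simp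
    ultimately have "P\<^sup>2 dvd c"
      using dvd by (simp add: coprime_dvd_mult_right_iff)
    then have "P\<^sup>2 dvd \<bar>c\<bar>"
      by simp
    then obtain m where m: "\<bar>c\<bar> = P\<^sup>2 * m" ..
    have PP: "3 * P \<le> P\<^sup>2"
      using P by (simp add: power2_eq_square)
    have qq: "q ^ d \<le> (P + 1)\<^sup>2" "2 \<le> q ^ d"
    proof -
      have "q ^ d \<le> q\<^sup>2"
        using xy(2) q by (intro power_increasing) auto
      also have "\<dots> \<le> (P + 1)\<^sup>2"
        using q by (intro power_mono) auto
      finally show "q ^ d \<le> (P + 1)\<^sup>2" .
      have "q ^ 1 \<le> q ^ d"
        using xy(2) q by (intro power_increasing) auto
      then show "2 \<le> q ^ d"
        using q by simp
    qed
    have s': "s1 = 1 \<or> s1 = - 1" "s2 = 1 \<or> s2 = - 1"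
      using s by linarith+
    then have c': "\<bar>c\<bar> = q ^ d + 1 \<or> \<bar>c\<bar> = q ^ d - 1"
      using qq(2) by (auto simp: c_def)
    have exp: "(P + 1)\<^sup>2 = P\<^sup>2 + 2 * P + 1"
      by (simp add: power2_eq_square algebra_simps)
    have "m \<ge> 1"
    proof (rule ccontr)
      assume "\<not> m \<ge> 1"
      then have "P\<^sup>2 * m \<le> P\<^sup>2 * 0"
        by (intro mult_left_mono) auto
      then show False
        using m c' qq(2) by auto
    qed
    moreover have "m < 2"
    proof (rule ccontr)
      assume "\<not> m < 2"
      then have "P\<^sup>2 * 2 \<le> P\<^sup>2 * m"
        by (intro mult_left_mono) auto
      then show False
        using m c' qq(1) exp PP P by linarith
    qed
    ultimately have "m = 1"
      by linarith
    then have "\<bar>q ^ d - P\<^sup>2\<bar> = 1"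
      using m c' by auto
    then show False
      using xy(2)
    proof (elim disjE)
      assume "d = 1"
      then show False
        using \<open>\<bar>q ^ d - P\<^sup>2\<bar> = 1\<close> PP q P by auto
    next
      assume "d = 2"
      then show False
        using \<open>\<bar>q ^ d - P\<^sup>2\<bar> = 1\<close> consecutive_squares[of q P] q P by auto
    qed
  qed
  have "y = x + (y - x) \<and> (y - x = 1 \<or> y - x = 2) \<or> x = y + (x - y) \<and> (x - y = 1 \<or> x - y = 2)"
    using near unfolding near_def by linarith
  then show ?thesis
    using main[of y x "y - x" s1 s2] main[of x y "x - y" s2 s1] s by (auto simp: add.commute)
qed

lemma signed_of_abs: "\<bar>x::int\<bar> = 2 * y \<Longrightarrow> \<exists>s. \<bar>s\<bar> = 1 \<and> x = 2 * (s * y)"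
proof (cases "x \<ge> 0")
  case True
  then show "\<bar>x\<bar> = 2 * y \<Longrightarrow> \<exists>s. \<bar>s\<bar> = 1 \<and> x = 2 * (s * y)"
    by (intro exI[of _ 1]) simp
next
  case False
  then show "\<bar>x\<bar> = 2 * y \<Longrightarrow> \<exists>s. \<bar>s\<bar> = 1 \<and> x = 2 * (s * y)"
    by (intro exI[of _ "- 1"]) simp
qed

text \<open>With \<open>w\<close> equal to \<open>000111\<close> the powers of \<open>P\<close> in all sums are known. The identity
\<open>(X\<^sub>0 + X\<^sub>2) + (X\<^sub>3 + X\<^sub>5) = (X\<^sub>0 + X\<^sub>3) + (X\<^sub>2 + X\<^sub>5) = (X\<^sub>0 + X\<^sub>5) + (X\<^sub>2 + X\<^sub>3)\<close> has sides with \<open>P\<close> to the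
powers \<open>0\<close>, \<open>1\<close> and \<open>3\<close>; by \<open>square_not_dvd_power_sum\<close> the exponents of \<open>q\<close> cannot be near, which makes \<open>u\<close> another
rotation of \<open>000111\<close>. Then \<open>X\<^sub>i + X\<^sub>i\<^sub>+\<^sub>3 = \<plusminus>2 q P\<close> for all \<open>i\<close>, and these three sums have opposite signs
wherever \<open>P\<^sup>2\<close> or \<open>q\<^sup>2\<close> divides a sum of two of them. The remaining two therefore agree in sign, but
their sum \<open>\<plusminus>4 q P\<close> is also a sum of two numbers \<open>\<plusminus>2\<close>.\<close>

lemma no_antipodal_codes:
  fixes X :: "nat \<Rightarrow> int" and q P :: int
  assumes U: "binary_code6 u e" and W: "binary_code6 w f"
    and w: "w 0 = w 1" "w 1 = w 2" "w 3 = w 4" "w 4 = w 5" "w 2 \<noteq> w 3"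
    and u: "\<not> (u 0 = u 1 \<and> u 1 = u 2)" "\<not> (u 3 = u 4 \<and> u 4 = u 5)"
    and q: "2 \<le> q" "q \<le> P + 1" "even q" and P: "3 \<le> P" and cop: "coprime P q"
    and sums: "\<And>i j. i < j \<Longrightarrow> j < 6 \<Longrightarrow>
      \<bar>X i + X j\<bar> = 2 * (q ^ binary_code6.k u e i j * P ^ binary_code6.k w f i j)"
  shows False
proof -
  interpret U: binary_code6 u e by (fact U)
  interpret W: binary_code6 w f by (fact W)
  have w': "w 1 = w 0" "w 2 = w 0" "w 3 = (\<not> w 0)" "w 4 = (\<not> w 0)" "w 5 = (\<not> w 0)"
    using w by auto
  have l: "W.k 0 2 = 0" "W.k 3 5 = 0" "W.k 0 3 = 1" "W.k 2 5 = 1" "W.k 0 5 = 3" "W.k 2 3 = 3"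
    "W.k 0 1 = 0" "W.k 3 4 = 0" "W.k 1 4 = 1" "W.k 1 2 = 0" "W.k 4 5 = 0"
    by (simp_all only: W.k_closed W.e_closed w') (simp_all add: numeral_eq_Suc)
  have form: "\<exists>s. \<bar>s\<bar> = 1 \<and> X i + X j = 2 * (s * (q ^ U.k i j * P ^ W.k i j))" if "i < j" "j < 6" for i j
    using signed_of_abs[OF sums[OF that]] .
  obtain a where a: "\<bar>a\<bar> = 1" "X 0 + X 2 = 2 * (a * q ^ U.k 0 2)"
    using form[of 0 2] l by auto
  obtain b where b: "\<bar>b\<bar> = 1" "X 3 + X 5 = 2 * (b * q ^ U.k 3 5)"
    using form[of 3 5] l by auto
  obtain c where c: "\<bar>c\<bar> = 1" "X 0 + X 3 = 2 * (c * (q ^ U.k 0 3 * P))"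
    using form[of 0 3] l by auto
  obtain d where d: "\<bar>d\<bar> = 1" "X 2 + X 5 = 2 * (d * (q ^ U.k 2 5 * P))"
    using form[of 2 5] l by auto
  obtain g where g: "X 0 + X 5 = 2 * (g * (q ^ U.k 0 5 * P ^ 3))"
    using form[of 0 5] l by auto
  obtain h where h: "X 2 + X 3 = 2 * (h * (q ^ U.k 2 3 * P ^ 3))"
    using form[of 2 3] l by auto
  obtain m where m: "\<bar>m\<bar> = 1" "X 1 + X 4 = 2 * (m * (q ^ U.k 1 4 * P))"
    using form[of 1 4] l by auto
  define z where "z = g * q ^ U.k 0 5 + h * q ^ U.k 2 3"
  have z: "2 * (P ^ 3 * z) = (X 0 + X 5) + (X 2 + X 3)"
    unfolding g h z_def by (simp add: algebra_simps)
  have "2 * (a * q ^ U.k 0 2 + b * q ^ U.k 3 5) = (X 0 + X 2) + (X 3 + X 5)"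
    unfolding a(2) b(2) by (simp add: algebra_simps)
  also have "\<dots> = 2 * (P ^ 3 * z)"
    unfolding z by simp
  finally have "a * q ^ U.k 0 2 + b * q ^ U.k 3 5 = P ^ 3 * z"
    by simp
  then have "a * q ^ U.k 0 2 + b * q ^ U.k 3 5 = P\<^sup>2 * (P * z)"
    by (simp only: power3_eq_cube power2_eq_square mult.assoc)
  then have n1: "\<not> near (U.k 0 2) (U.k 3 5)"
    using square_not_dvd_power_sum[OF q(1,2) P cop _ a(1) b(1)] by (metis dvd_triv_left)
  have "2 * (P * (c * q ^ U.k 0 3 + d * q ^ U.k 2 5)) = (X 0 + X 3) + (X 2 + X 5)"
    unfolding c(2) d(2) by (simp add: algebra_simps)
  also have "\<dots> = 2 * (P ^ 3 * z)"
    unfolding z by simp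
  finally have "P * (c * q ^ U.k 0 3 + d * q ^ U.k 2 5) = P ^ 3 * z"
    by simp
  then have "P * (c * q ^ U.k 0 3 + d * q ^ U.k 2 5) = P * (P\<^sup>2 * z)"
    by (simp only: power3_eq_cube power2_eq_square mult.assoc)
  then have cd: "c * q ^ U.k 0 3 + d * q ^ U.k 2 5 = P\<^sup>2 * z"
    using P by (metis mult_left_cancel not_numeral_le_zero)
  then have n2: "\<not> near (U.k 0 3) (U.k 2 5)"
    using square_not_dvd_power_sum[OF q(1,2) P cop _ c(1) d(1)] by (metis dvd_triv_left)
  have small: "x = 0" if "y\<^sup>2 dvd x" "\<bar>x\<bar> \<le> 2" "2 \<le> y" for x y :: int
  proof (rule ccontr)
    assume "x \<noteq> 0"
    then have "y\<^sup>2 \<le> \<bar>x\<bar>"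
      using that(1) by (meson dvd_abs_iff zdvd_imp_le zero_less_abs_iff)
    moreover have "2\<^sup>2 \<le> y\<^sup>2"
      using that(3) by (intro power_mono) auto
    ultimately show False
      using that(2) by simp
  qed
  have cop': "coprime (P\<^sup>2) q" "coprime (q\<^sup>2) P"
    using cop by (simp_all add: coprime_commute)
  \<comment> \<open>Across a pair whose sums carry \<open>q\<^sup>3\<close>, two of the sums \<open>\<plusminus>2 q P\<close> cancel.\<close>
  have antipodal_sum: "x + y = 0"
    if "x * (q * P) + y * (q * P) = x' * q ^ 3 + y' * q ^ 3" "\<bar>x\<bar> = 1" "\<bar>y\<bar> = 1" for x y x' y'
  proof -
    have "q * ((x + y) * P) = q * (q\<^sup>2 * (x' + y'))"
      using that(1) by (simp add: algebra_simps power2_eq_square power3_eq_cube)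
    then have "(x + y) * P = q\<^sup>2 * (x' + y')"
      using q by simp
    then have "q\<^sup>2 dvd (x + y) * P"
      by simp
    then have "q\<^sup>2 dvd x + y"
      using cop'(2) by (simp add: coprime_dvd_mult_left_iff)
    then show ?thesis
      using small q(1) that(2,3) by (smt (verit))
  qed
  have not_unit_sum: False
    if "x * (q * P) + x * (q * P) = x' + y'" "\<bar>x\<bar> = 1" "\<bar>x'\<bar> = 1" "\<bar>y'\<bar> = 1" for x x' y'
  proof -
    have "2 * 3 \<le> q * P"
      using q P by (intro mult_mono) auto
    moreover have "x = 1 \<or> x = - 1"
      using that(2) by linarith
    then have "x * (q * P) = q * P \<or> x * (q * P) = - (q * P)"
      by auto
    ultimately show False
      using that(1,3,4) by linarith
  qed
  have cd0: "c + d = 0" if "U.k 0 3 = 1" "U.k 2 5 = 1"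
  proof -
    have "P\<^sup>2 dvd (c + d) * q"
      using cd that by (simp add: algebra_simps)
    then have "P\<^sup>2 dvd c + d"
      using cop'(1) by (simp add: coprime_dvd_mult_left_iff)
    then show ?thesis
      using small P c(1) d(1) by (smt (verit))
  qed
  have x01: "\<exists>s. \<bar>s\<bar> = 1 \<and> X 0 + X 1 = 2 * (s * q ^ U.k 0 1)" "\<exists>s. \<bar>s\<bar> = 1 \<and> X 3 + X 4 = 2 * (s * q ^ U.k 3 4)"
    "\<exists>s. \<bar>s\<bar> = 1 \<and> X 1 + X 2 = 2 * (s * q ^ U.k 1 2)" "\<exists>s. \<bar>s\<bar> = 1 \<and> X 4 + X 5 = 2 * (s * q ^ U.k 4 5)"
    using form[of 0 1] form[of 3 4] form[of 1 2] form[of 4 5] l by auto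
  obtain s1 where s1: "\<bar>s1\<bar> = 1" "X 0 + X 1 = 2 * (s1 * q ^ U.k 0 1)"
    using x01(1) by blast
  obtain s2 where s2: "\<bar>s2\<bar> = 1" "X 3 + X 4 = 2 * (s2 * q ^ U.k 3 4)"
    using x01(2) by blast
  obtain s3 where s3: "\<bar>s3\<bar> = 1" "X 1 + X 2 = 2 * (s3 * q ^ U.k 1 2)"
    using x01(3) by blast
  obtain s4 where s4: "\<bar>s4\<bar> = 1" "X 4 + X 5 = 2 * (s4 * q ^ U.k 4 5)"
    using x01(4) by blast
  have eq1: "c * (q ^ U.k 0 3 * P) + m * (q ^ U.k 1 4 * P) = s1 * q ^ U.k 0 1 + s2 * q ^ U.k 3 4"
    using c(2) m(2) s1(2) s2(2) by linarith
  have eq2: "m * (q ^ U.k 1 4 * P) + d * (q ^ U.k 2 5 * P) = s3 * q ^ U.k 1 2 + s4 * q ^ U.k 4 5"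
    using d(2) m(2) s3(2) s4(2) by linarith
  from U.near_cases[OF u] n1 n2
  consider "u 1 = u 2" "u 2 = u 3" "u 3 \<noteq> u 4" "u 4 = u 5" "u 5 = u 0"
    | "u 2 = u 3" "u 3 = u 4" "u 4 \<noteq> u 5" "u 5 = u 0" "u 0 = u 1"
    by blast
  then show False
  proof cases
    case 1
    then have u': "u 1 = (\<not> u 0)" "u 2 = (\<not> u 0)" "u 3 = (\<not> u 0)" "u 4 = u 0" "u 5 = u 0"
      by auto
    have k: "U.k 0 3 = 1" "U.k 2 5 = 1" "U.k 1 4 = 1" "U.k 0 1 = 3" "U.k 3 4 = 3" "U.k 1 2 = 0" "U.k 4 5 = 0"
      by (simp_all only: U.k_closed U.e_closed u') (simp_all add: numeral_eq_Suc)
    have "c + m = 0"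
      using antipodal_sum[of c m s1 s2] eq1[unfolded k] c(1) m(1) by simp
    with cd0[OF k(1,2)] have "m = d"
      by linarith
    then show False
      using not_unit_sum[of d s3 s4] eq2[unfolded k] d(1) s3(1) s4(1) by simp
  next
    case 2
    then have u': "u 1 = u 0" "u 2 = (\<not> u 0)" "u 3 = (\<not> u 0)" "u 4 = (\<not> u 0)" "u 5 = u 0"
      by auto
    have k: "U.k 0 3 = 1" "U.k 2 5 = 1" "U.k 1 4 = 1" "U.k 1 2 = 3" "U.k 4 5 = 3" "U.k 0 1 = 0" "U.k 3 4 = 0"
      by (simp_all only: U.k_closed U.e_closed u') (simp_all add: numeral_eq_Suc)
    have "m + d = 0"
      using antipodal_sum[of m d s3 s4] eq2[unfolded k] d(1) m(1) by simp
    with cd0[OF k(1,2)] have "m = c"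
      by linarith
    then show False
      using not_unit_sum[of c s1 s2] eq1[unfolded k] c(1) s1(1) s2(1) by simp
  qed
qed

section \<open>No cycle of period six\<close>

locale six_cycle = two_prime_cycle +
  assumes n6: "n = 6"
begin

lemma p_dvd: "p dvd D"
  using p_dvd_D n6 by simp

lemma multiplicity_step:
  assumes "prime l" "i mod n \<noteq> j mod n"
  shows "multiplicity l (X i - X j) + multiplicity l (X i + X j)
    = multiplicity l D + multiplicity l (X (Suc i) - X (Suc j))"
proof -
  have "multiplicity l ((X i - X j) * (X i + X j)) = multiplicity l (D * (X (Suc i) - X (Suc j)))"
    by (simp only: diff_step)
  then show ?thesis
    using assms X_neq[OF assms(2)] X_neq[OF mod_Suc_neq[OF assms(2)]] sum_nonzero[OF assms(2)] D_pos
    by (subst (asm) (1 2) prime_elem_multiplicity_mult_distrib) auto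
qed

lemma multiplicity_2_eq_1:
  fixes x :: int
  assumes "even x" "\<not> 4 dvd x"
  shows "multiplicity 2 x = 1"
  using assms by (intro multiplicity_eqI) auto

lemma multiplicity_2_ge_2:
  fixes x :: int
  assumes "x \<noteq> 0" "4 dvd x"
  shows "2 \<le> multiplicity 2 x"
  using assms by (intro multiplicity_geI) auto

lemma even_diff: "even (X i - X j)" and even_sum: "even (X i + X j)"
  using X_odd by simp_all

lemma multiplicity_2_diff_ge_1: "i mod n \<noteq> j mod n \<Longrightarrow> 1 \<le> multiplicity 2 (X i - X j)"
  using X_neq even_diff by (intro multiplicity_geI) auto

text \<open>Here \<open>D = 2\<^sup>r p\<^sup>t = 2 q P\<close>. One of the factors \<open>2\<close> of \<open>D\<close> is set apart because \<open>X\<^sub>i - X\<^sub>j\<close> and \<open>X\<^sub>i + X\<^sub>j\<close> are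
both even: with it removed, one step in a common class costs a difference exactly \<open>q\<close> or \<open>P\<close>.\<close>

definition r :: nat where "r = multiplicity 2 D"
definition t :: nat where "t = multiplicity p D"
definition q :: int where "q = 2 ^ (r - 1)"
definition P :: int where "P = p ^ t"
definition eu :: "nat \<Rightarrow> nat \<Rightarrow> nat" where "eu i j = (multiplicity 2 (X i - X j) - 1) div (r - 1)"
definition ew :: "nat \<Rightarrow> nat \<Rightarrow> nat" where "ew i j = multiplicity p (X i - X j) div t"

lemma t_ge_1: "1 \<le> t"
  unfolding t_def using p_dvd D_pos p by (intro multiplicity_geI) auto

lemma u_not_constant: "\<exists>i j. i mod n \<noteq> j mod n \<and> u i \<noteq> u j"
proof (rule ccontr)
  assume "\<not> ?thesis"
  then have all: "u i = u 0" if "i < n" for i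
    using that n6 by (metis mod_less mod_0 neq0_conv n_pos)
  have empty: "class_of (\<not> u 0) b = {}" for b
  proof -
    have "i \<notin> class_of (\<not> u 0) b" for i
      using all[of i] unfolding class_of_def by blast
    then show ?thesis
      by blast
  qed
  have n5: "n \<ge> 5"
    using n6 by simp
  have "card (class_of True b) + card (class_of False b) \<le> 2" for b
  proof (cases "u 0")
    case True
    then have "class_of False b = {}"
      using empty[of b] by simp
    then show ?thesis
      using card_class_le_2[OF n5, of True b] by simp
  next
    case False
    then have "class_of True b = {}"
      using empty[of b] by simp
    then show ?thesis
      using card_class_le_2[OF n5, of False b] by simp
  qed
  from this[of True] this[of False] show False
    using n_eq_card card_w_class[of True] card_w_class[of False] n6 by linarith
qed

text \<open>For \<open>r = 1\<close> a difference divisible by \<open>4\<close> would stay so forever, while two members that differ modulo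
\<open>4\<close> have a difference that becomes divisible by \<open>4\<close> after one step and returns after six.\<close>

lemma r_ge_2: "2 \<le> r"
proof (rule ccontr)
  assume "\<not> 2 \<le> r"
  moreover have "1 \<le> r"
    unfolding r_def using two_dvd_D D_pos by (intro multiplicity_geI) auto
  ultimately have r: "multiplicity 2 D = 1"
    by (simp add: r_def)
  obtain i j where ij: "i mod n \<noteq> j mod n" "u i \<noteq> u j"
    using u_not_constant by blast
  have step2: "multiplicity 2 (X i - X j) + multiplicity 2 (X i + X j)
      = 1 + multiplicity 2 (X (Suc i) - X (Suc j))" if "i mod n \<noteq> j mod n" for i j
    using multiplicity_step[OF _ that, of 2] r by simp
  have *: "2 \<le> multiplicity 2 (X (i + Suc k) - X (j + Suc k))" for k
  proof (induction k)
    case 0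
    have "2 \<le> multiplicity 2 (X i + X j)"
      using u_neq(1)[OF ij(2)] sum_nonzero[OF ij(1)] by (rule multiplicity_2_ge_2[rotated])
    then show ?case
      using step2[OF ij(1)] multiplicity_2_diff_ge_1[OF ij(1)] by simp
  next
    case (Suc k)
    have ne: "(i + Suc k) mod n \<noteq> (j + Suc k) mod n"
      using ij(1) by (rule mod_neq_add)
    have "1 \<le> multiplicity 2 (X (i + Suc k) + X (j + Suc k))"
      using sum_nonzero[OF ne] even_sum by (intro multiplicity_geI) auto
    then show ?case
      using step2[OF ne] Suc by simp
  qed
  have "2 \<le> multiplicity 2 (X i - X j)"
    using *[of 5] X_add_n[of i] X_add_n[of j] n6 by simp
  then show False
    using multiplicity_2_eq_1[OF even_diff u_neq(2)[OF ij(2)]] by simp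
qed

lemma D_eq: "D = 2 * q * P"
proof -
  have "\<bar>D\<bar> = 2 ^ r * P"
    unfolding r_def t_def P_def using D_pos
    by (intro abs_eq_two_prime_powers p(1) p_neq_2 primes_D) auto
  moreover have "2 ^ r = 2 * q"
    using r_ge_2 by (simp add: q_def power_eq_if)
  ultimately show ?thesis
    using D_pos by simp
qed

text \<open>One step divides the product of difference and sum by \<open>D\<close>. Of the two factors one is \<open>2\<close> modulo \<open>4\<close>, so the
other one absorbs the remaining power \<open>2\<^sup>r\<^sup>-\<^sup>1\<close>; which one is decided by the residues.\<close>

lemma multiplicity_2_step:
  assumes "i mod n \<noteq> j mod n"
  shows "u i = u j \<Longrightarrow> multiplicity 2 (X i - X j) = (r - 1) + multiplicity 2 (X (Suc i) - X (Suc j))"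
    and "u i = u j \<Longrightarrow> multiplicity 2 (X i + X j) = 1"
    and "u i \<noteq> u j \<Longrightarrow> multiplicity 2 (X i - X j) = 1"
    and "u i \<noteq> u j \<Longrightarrow> multiplicity 2 (X i + X j) = (r - 1) + multiplicity 2 (X (Suc i) - X (Suc j))"
proof -
  have *: "multiplicity 2 (X i - X j) + multiplicity 2 (X i + X j) = r + multiplicity 2 (X (Suc i) - X (Suc j))"
    using multiplicity_step[OF _ assms, of 2] by (simp add: r_def)
  show sum: "multiplicity 2 (X i + X j) = 1" if "u i = u j"
    using multiplicity_2_eq_1[OF even_sum u_eq[OF that]] .
  show diff: "multiplicity 2 (X i - X j) = 1" if "u i \<noteq> u j"
    using multiplicity_2_eq_1[OF even_diff u_neq(2)[OF that]] .
  show "u i = u j \<Longrightarrow> multiplicity 2 (X i - X j) = (r - 1) + multiplicity 2 (X (Suc i) - X (Suc j))"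
    using * sum r_ge_2 by simp
  show "u i \<noteq> u j \<Longrightarrow> multiplicity 2 (X i + X j) = (r - 1) + multiplicity 2 (X (Suc i) - X (Suc j))"
    using * diff r_ge_2 by simp
qed

lemma multiplicity_p_step:
  assumes "i mod n \<noteq> j mod n"
  shows "w i = w j \<Longrightarrow> multiplicity p (X i - X j) = t + multiplicity p (X (Suc i) - X (Suc j))"
    and "w i = w j \<Longrightarrow> multiplicity p (X i + X j) = 0"
    and "w i \<noteq> w j \<Longrightarrow> multiplicity p (X i - X j) = 0"
    and "w i \<noteq> w j \<Longrightarrow> multiplicity p (X i + X j) = t + multiplicity p (X (Suc i) - X (Suc j))"
proof -
  have *: "multiplicity p (X i - X j) + multiplicity p (X i + X j) = t + multiplicity p (X (Suc i) - X (Suc j))"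
    using multiplicity_step[OF p(1) assms] by (simp add: t_def)
  show sum: "multiplicity p (X i + X j) = 0" if "w i = w j"
    using that w_eq_iff[OF p_dvd] not_p_dvd_diff_and_sum[OF p_dvd] by (blast intro: not_dvd_imp_multiplicity_0)
  show diff: "multiplicity p (X i - X j) = 0" if "w i \<noteq> w j"
    using that w_eq_iff[OF p_dvd] by (blast intro: not_dvd_imp_multiplicity_0)
  show "w i = w j \<Longrightarrow> multiplicity p (X i - X j) = t + multiplicity p (X (Suc i) - X (Suc j))"
    using * sum by simp
  show "w i \<noteq> w j \<Longrightarrow> multiplicity p (X i + X j) = t + multiplicity p (X (Suc i) - X (Suc j))"
    using * diff by simp
qed

lemma eu_rec:
  assumes "i mod n \<noteq> j mod n"
  shows "eu i j = (if u i = u j then Suc (eu (Suc i) (Suc j)) else 0)"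
proof (cases "u i = u j")
  case True
  have "multiplicity 2 (X i - X j) - 1 = (r - 1) + (multiplicity 2 (X (Suc i) - X (Suc j)) - 1)"
    using multiplicity_2_step(1)[OF assms True] multiplicity_2_diff_ge_1[OF mod_Suc_neq[OF assms]] by simp
  then have "eu i j = ((r - 1) + (multiplicity 2 (X (Suc i) - X (Suc j)) - 1)) div (r - 1)"
    unfolding eu_def by (rule arg_cong)
  also have "\<dots> = Suc (eu (Suc i) (Suc j))"
    unfolding eu_def using r_ge_2 by (subst div_add_self1) auto
  finally show ?thesis
    using True by simp
qed (use multiplicity_2_step(3)[OF assms] in \<open>simp add: eu_def\<close>)

lemma ew_rec:
  assumes "i mod n \<noteq> j mod n"
  shows "ew i j = (if w i = w j then Suc (ew (Suc i) (Suc j)) else 0)"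
  using multiplicity_p_step(1,3)[OF assms] t_ge_1 by (auto simp: ew_def)

lemma multiplicity_2_diff:
  assumes "i mod n \<noteq> j mod n"
  shows "multiplicity 2 (X i - X j) = 1 + (r - 1) * eu i j"
  using assms
proof (induction "multiplicity 2 (X i - X j)" arbitrary: i j rule: less_induct)
  case less
  show ?case
  proof (cases "u i = u j")
    case True
    have "multiplicity 2 (X (Suc i) - X (Suc j)) = 1 + (r - 1) * eu (Suc i) (Suc j)"
      using less multiplicity_2_step(1)[OF less.prems True] r_ge_2 mod_Suc_neq by simp
    then show ?thesis
      using multiplicity_2_step(1)[OF less.prems True] eu_rec[OF less.prems] True by simp
  qed (use multiplicity_2_step(3)[OF less.prems] eu_rec[OF less.prems] in simp)
qed

lemma multiplicity_p_diff:
  assumes "i mod n \<noteq> j mod n"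
  shows "multiplicity p (X i - X j) = t * ew i j"
  using assms
proof (induction "multiplicity p (X i - X j)" arbitrary: i j rule: less_induct)
  case less
  show ?case
  proof (cases "w i = w j")
    case True
    have "multiplicity p (X (Suc i) - X (Suc j)) = t * ew (Suc i) (Suc j)"
      using less multiplicity_p_step(1)[OF less.prems True] t_ge_1 mod_Suc_neq by simp
    then show ?thesis
      using multiplicity_p_step(1)[OF less.prems True] ew_rec[OF less.prems] True by simp
  qed (use multiplicity_p_step(3)[OF less.prems] ew_rec[OF less.prems] in simp)
qed

sublocale U: binary_code6 u eu
proof
  fix i j :: nat
  show "u (i + 6) = u i" "eu (i + 6) j = eu i j"
    using X_add_n[of i] n6 by (simp_all add: u_def eu_def)
  show "eu i j = eu j i"
    unfolding eu_def by (metis abs_minus_commute multiplicity_normalize_right normalize_int_def)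
qed (use eu_rec n6 in simp)

sublocale W: binary_code6 w ew
proof
  fix i j :: nat
  show "w (i + 6) = w i" "ew (i + 6) j = ew i j"
    using X_add_n[of i] n6 by (simp_all add: w_def ew_def)
  show "ew i j = ew j i"
    unfolding ew_def by (metis abs_minus_commute multiplicity_normalize_right normalize_int_def)
qed (use ew_rec n6 in simp)

lemma abs_sum_eq:
  assumes "i mod n \<noteq> j mod n"
  shows "\<bar>X i + X j\<bar> = 2 * (q ^ U.k i j * P ^ W.k i j)"
proof -
  have "multiplicity 2 (X i + X j) = 1 + (r - 1) * U.k i j"
    using multiplicity_2_step(2,4)[OF assms] multiplicity_2_diff[OF mod_Suc_neq[OF assms]]
    by (auto simp: U.k_def)
  moreover have "multiplicity p (X i + X j) = t * W.k i j"
    using multiplicity_p_step(2,4)[OF assms] multiplicity_p_diff[OF mod_Suc_neq[OF assms]]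
    by (auto simp: W.k_def)
  ultimately show ?thesis
    using abs_sum[OF assms] by (simp add: q_def P_def power_mult)
qed

lemma diff_eq:
  assumes "i mod n \<noteq> j mod n"
  shows "\<exists>m. X i - X j = 2 * (q ^ eu i j * P ^ ew i j) * m \<and> coprime m D"
proof -
  let ?d = "X i - X j"
  have d0: "?d \<noteq> 0"
    by (rule X_neq[OF assms])
  have two: "\<not> is_unit (2::int)" and pu: "\<not> is_unit p"
    using p(1) by auto
  obtain x where x: "?d = 2 ^ multiplicity 2 ?d * x" "\<not> 2 dvd x"
    using multiplicity_decompose'[OF d0 two] .
  have x0: "x \<noteq> 0"
    using x d0 by auto
  obtain m where m: "x = p ^ multiplicity p x * m" "\<not> p dvd m"
    using multiplicity_decompose'[OF x0 pu] .
  have "multiplicity p ?d = multiplicity p (2 ^ multiplicity 2 ?d) + multiplicity p x"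
    using x0 p(1) by (subst x(1), subst prime_elem_multiplicity_mult_distrib) auto
  moreover have "multiplicity p (2 ^ multiplicity 2 ?d) = 0"
    using not_p_dvd_two_power by (rule not_dvd_imp_multiplicity_0)
  ultimately have "multiplicity p x = t * ew i j"
    using multiplicity_p_diff[OF assms] by simp
  then have "?d = 2 ^ (1 + (r - 1) * eu i j) * (p ^ (t * ew i j) * m)"
    using x(1) m(1) multiplicity_2_diff[OF assms] by metis
  then have "?d = 2 * (q ^ eu i j * P ^ ew i j) * m"
    by (simp add: q_def P_def power_mult)
  moreover have "odd m"
    using x(2) m(1) by (metis dvd_mult)
  then have "coprime m D"
    using m(2) by (intro coprime_D_iff) auto
  ultimately show ?thesis
    by blast
qed

text \<open>Even steps that are not multiples of six reach all places of the same parity, and one further step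
passes to the other parity.\<close>

lemma coprime_dvd_same_parity:
  assumes m: "coprime m D" "m dvd X i - X j" and ij: "i mod n \<noteq> j mod n" "even (i + j)" and ab: "even (a + b)"
  shows "m dvd X a - X b"
proof -
  define d where "d = j + 5 * i"
  have d: "i + d = j + i * n"
    by (simp add: d_def n6)
  have "even d"
    using ij(2) by (simp add: d_def)
  moreover have "d mod 6 \<noteq> 0"
  proof
    assume "d mod 6 = 0"
    then have "(i + d) mod n = i mod n"
      unfolding n6 by (metis add.right_neutral mod_add_right_eq)
    then show False
      using ij(1) by (simp add: d)
  qed
  ultimately have "d mod 6 = 2 \<or> d mod 6 = 4"
    by presburger
  then obtain e where e: "d = 6 * e + 2 \<or> d = 6 * e + 4"
    by (metis div_mult_mod_eq mult.commute)
  \<comment> \<open>Some multiple of the step \<open>d\<close> is congruent to \<open>a - i\'\<close> modulo six.\<close>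
  have claim: "m dvd X i' - X a" if i': "m dvd X i' - X (i' + d)" and par: "even (i' + a)" for i' a
  proof -
    obtain c where c: "a + 5 * i' = 2 * c"
      using par by (metis dvdE even_add even_mult_iff odd_numeral)
    have "\<exists>k. (i' + k * d) mod 6 = a mod 6"
      using e
    proof
      assume "d = 6 * e + 2"
      then have "i' + c * d = a + 6 * (i' + c * e)"
        using c by (simp add: algebra_simps)
      then have "(i' + c * d) mod 6 = a mod 6"
        by simp
      then show ?thesis ..
    next
      assume "d = 6 * e + 4"
      then have "i' + (2 * c) * d = a + 6 * (i' + c + 2 * c * e)"
        using c by (simp add: algebra_simps)
      then have "(i' + (2 * c) * d) mod 6 = a mod 6"
        by (simp only: mod_mult_self2)
      then show ?thesis ..
    qed
    then obtain k where "X (i' + k * d) = X a"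
      by (auto simp: inj n6)
    then show ?thesis
      using coprime_dvd_multiples[OF m(1) i', of k] by simp
  qed
  have "X (i + d) = X j"
    unfolding d inj by simp
  then have start: "m dvd X i - X (i + d)"
    using m(2) by simp
  have start': "m dvd X (i + 1) - X (i + 1 + d)"
    using coprime_dvd_shift[OF m(1) start, of 1] by (simp add: add_ac)
  have "\<exists>i'. m dvd X i' - X (i' + d) \<and> even (i' + a)"
  proof (cases "even (i + a)")
    case True
    then show ?thesis
      using start by blast
  next
    case False
    then have "even (i + 1 + a)"
      by simp
    then show ?thesis
      using start' by blast
  qed
  then obtain i' where i': "m dvd X i' - X (i' + d)" "even (i' + a)"
    by blast
  then have "even (i' + b)"
    using ab by simp
  from dvd_diff[OF claim[OF i'(1) this] claim[OF i']]
  have "m dvd (X i' - X b) - (X i' - X a)" .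
  then show ?thesis
    by simp
qed

lemma coprime_two_q_P:
  assumes "coprime m D"
  shows "coprime m (2 * (q ^ a * P ^ b))"
proof -
  have "coprime m (2 * q * P)"
    using assms by (simp only: D_eq[symmetric])
  then show ?thesis
    by simp
qed

text \<open>The parts prime to \<open>D\<close> of all these differences divide each other.\<close>

lemma same_parity_diff_eq:
  "\<exists>M. M \<noteq> 0 \<and> (\<forall>i j. i mod n \<noteq> j mod n \<longrightarrow> even (i + j) \<longrightarrow>
     (\<exists>s. \<bar>s\<bar> = 1 \<and> X i - X j = 2 * M * (s * q ^ eu i j * P ^ ew i j)))"
proof -
  have ne: "0 mod n \<noteq> 2 mod n"
    using n6 by simp
  \<comment> \<open>The pair \<open>0, 2\<close> serves as the reference for all others.\<close>
  obtain M where M: "X 0 - X 2 = 2 * (q ^ eu 0 2 * P ^ ew 0 2) * M" "coprime M D"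
    using diff_eq[OF ne] by blast
  have "M \<noteq> 0"
    using M(1) X_neq[OF ne] by auto
  moreover have "\<exists>s. \<bar>s\<bar> = 1 \<and> X i - X j = 2 * M * (s * q ^ eu i j * P ^ ew i j)"
    if ij: "i mod n \<noteq> j mod n" "even (i + j)" for i j
  proof -
    obtain m where m: "X i - X j = 2 * (q ^ eu i j * P ^ ew i j) * m" "coprime m D"
      using diff_eq[OF ij(1)] by blast
    have "m dvd X 0 - X 2"
      using coprime_dvd_same_parity[OF m(2) _ ij, of 0 2] m(1) by simp
    then have "m dvd M"
      unfolding M(1) using coprime_two_q_P[OF m(2)] by (simp add: coprime_dvd_mult_right_iff)
    have "M dvd X i - X j"
      using coprime_dvd_same_parity[OF M(2) _ ne _ ij(2)] M(1) by simp
    then have "M dvd m"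
      unfolding m(1) using coprime_two_q_P[OF M(2)] by (simp add: coprime_dvd_mult_right_iff)
    then have "\<bar>m\<bar> = \<bar>M\<bar>"
      using \<open>m dvd M\<close> by (intro zdvd_antisym_abs)
    then have "m = M * 1 \<or> m = M * (- 1)"
      by linarith
    then obtain s where "m = M * s" "\<bar>s\<bar> = 1"
      by (metis abs_1 abs_minus_cancel)
    then show ?thesis
      using m(1) by (intro exI[of _ s]) (simp add: mult_ac)
  qed
  ultimately show ?thesis
    by blast
qed

lemma q_ge_2: "2 \<le> q" and even_q: "even q"
proof -
  obtain k where "r - 1 = Suc k"
    using r_ge_2 by (metis Suc_le_D diff_Suc_1 numeral_2_eq_2 Suc_le_mono)
  then show "2 \<le> q" "even q"
    by (simp_all add: q_def)
qed

lemma P_ge_3: "3 \<le> P"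
proof -
  have "p ^ 1 \<le> p ^ t"
    using t_ge_1 p_ge_3 by (intro power_increasing) auto
  then show ?thesis
    using p_ge_3 by (simp add: P_def)
qed

lemma coprime_P_q: "coprime P q"
proof -
  have "coprime p 2"
    using not_p_dvd_two_power[of 1] p(1) by (intro prime_imp_coprime) auto
  then show ?thesis
    by (simp add: P_def q_def)
qed

text \<open>The three differences of \<open>X\<^sub>i, X\<^sub>i\<^sub>+\<^sub>2, X\<^sub>i\<^sub>+\<^sub>4\<close> add up to zero; cancelling the factor \<open>2 M\<close> leaves an
equation between signed products of powers of \<open>q\<close> and \<open>P\<close>.\<close>

lemma gaps_adjacent:
  assumes "a \<ge> 1" "b \<ge> 1" "gap a (eu i (i + 2)) (eu (i + 2) (i + 4)) (eu i (i + 4))"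
    "gap b (ew i (i + 2)) (ew (i + 2) (i + 4)) (ew i (i + 4))"
  shows "\<bar>q ^ a - P ^ b\<bar> = 1"
proof -
  obtain M where M: "M \<noteq> 0"
    and diff: "\<And>i j. i mod n \<noteq> j mod n \<Longrightarrow> even (i + j) \<Longrightarrow>
      \<exists>s. \<bar>s\<bar> = 1 \<and> X i - X j = 2 * M * (s * q ^ eu i j * P ^ ew i j)"
    using same_parity_diff_eq by blast
  have ne: "i mod n \<noteq> (i + 2) mod n" "(i + 2) mod n \<noteq> (i + 4) mod n" "i mod n \<noteq> (i + 4) mod n"
    unfolding n6 by presburger+
  obtain s1 where s1: "\<bar>s1\<bar> = 1" "X i - X (i + 2) = 2 * M * (s1 * q ^ eu i (i + 2) * P ^ ew i (i + 2))"
    using diff[OF ne(1)] by auto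
  obtain s2 where s2: "\<bar>s2\<bar> = 1"
    "X (i + 2) - X (i + 4) = 2 * M * (s2 * q ^ eu (i + 2) (i + 4) * P ^ ew (i + 2) (i + 4))"
    using diff[OF ne(2)] by auto
  obtain s3 where s3: "\<bar>s3\<bar> = 1" "X i - X (i + 4) = 2 * M * (s3 * q ^ eu i (i + 4) * P ^ ew i (i + 4))"
    using diff[OF ne(3)] by auto
  let ?c = "s1 * q ^ eu i (i + 2) * P ^ ew i (i + 2) + s2 * q ^ eu (i + 2) (i + 4) * P ^ ew (i + 2) (i + 4)
      + (- s3) * q ^ eu i (i + 4) * P ^ ew i (i + 4)"
  have "2 * M * ?c = (X i - X (i + 2)) + (X (i + 2) - X (i + 4)) - (X i - X (i + 4))"
    unfolding s1(2) s2(2) s3(2) by (simp add: algebra_simps)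
  then have "2 * M * ?c = 0"
    by simp
  then have "?c = 0"
    using M by simp
  then show ?thesis
    using triple_gap[OF q_ge_2 P_ge_3 assms(1,2) assms(3,4) s1(1) s2(1), of "- s3"] s3(1) by simp
qed

text \<open>A gap two of \<open>w\<close> would put \<open>P\<close> next to a power of \<open>q\<close> and \<open>P\<^sup>2\<close> next to \<open>q\<close> or \<open>q\<^sup>2\<close>.\<close>

lemma no_gap_two:
  assumes "\<bar>q ^ a - P ^ 1\<bar> = 1" "\<bar>q ^ b - P ^ 2\<bar> = 1" "a = 1 \<or> a = 2" "b = 1 \<or> b = 2"
  shows False
proof (cases "b = 2")
  case True
  then show False
    using assms(2) consecutive_squares[of q P] q_ge_2 P_ge_3 by simp
next
  case False
  then have "P\<^sup>2 \<le> q + 1"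
    using assms(2,4) by auto
  moreover have "q ^ 1 \<le> q ^ a"
    using assms(3) q_ge_2 by (intro power_increasing) auto
  then have "q \<le> P + 1"
    using assms(1) by auto
  moreover have "3 * P \<le> P\<^sup>2"
    using P_ge_3 by (simp add: power2_eq_square)
  ultimately show False
    using P_ge_3 by linarith
qed

lemma w_balanced: "of_bool (w 0) + of_bool (w 1) + of_bool (w 2) + of_bool (w 3) + of_bool (w 4) + of_bool (w 5) = (3::nat)"
proof -
  have n5: "5 \<le> n"
    using n6 by simp
  have "card {i \<in> {..<n}. w i = True} = 3"
    using n_eq_card card_w_class_le_3[OF n5, of True] card_w_class_le_3[OF n5, of False] n6 by linarith
  moreover have "card {i \<in> {..<n}. w i = True} = (\<Sum>i<n. of_bool (w i))"
    by (simp add: sum.If_cases of_bool_def Int_def)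
  ultimately show ?thesis
    by (simp add: n6 eval_nat_numeral)
qed

lemma six_cycle_impossible: False
proof -
  have n5: "5 \<le> n"
    using n6 by simp
  obtain a where a: "a = 1 \<or> a = 2" "gap a (eu 0 2) (eu 2 4) (eu 0 4)"
    using U.gap_even by blast
  obtain b where b: "b = 1 \<or> b = 2" "gap b (eu 1 3) (eu 3 5) (eu 1 5)"
    using U.gap_odd by blast
  have ab1: "1 \<le> a" "1 \<le> b"
    using a b by auto
  have even: "\<bar>q ^ a - P ^ x\<bar> = 1" if "gap x (ew 0 2) (ew 2 4) (ew 0 4)" "1 \<le> x" for x
    using gaps_adjacent[of a x 0] a(2) that ab1 by (simp add: numeral_eq_Suc)
  have odd: "\<bar>q ^ b - P ^ x\<bar> = 1" if "gap x (ew 1 3) (ew 3 5) (ew 1 5)" "1 \<le> x" for x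
    using gaps_adjacent[of b x 1] b(2) that ab1 by (simp add: numeral_eq_Suc)
  \<comment> \<open>Both words with a gap two are excluded, so \<open>w\<close> changes its letter after three places.\<close>
  have anti: "w 0 \<noteq> w 3 \<and> w 1 \<noteq> w 4 \<and> w 2 \<noteq> w 5" "gap 1 (ew 0 2) (ew 2 4) (ew 0 4)"
    using W.balanced_cases[OF w_balanced] even[of 1] even[of 2] odd[of 1] odd[of 2]
      no_gap_two[OF _ _ a(1) b(1)] no_gap_two[OF _ _ b(1) a(1)] by auto
  have "q ^ 1 \<le> q ^ a"
    using ab1 q_ge_2 by (intro power_increasing) auto
  then have q_le: "q \<le> P + 1"
    using even[OF anti(2)] by auto
  have w67: "w 6 = w 0" "w 7 = w 1"
    using W.periodic[of 0] W.periodic[of 1] by simp_all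
  have "\<not> (w 0 = w 2 \<and> w 1 = w 3 \<and> w 2 = w 4 \<and> w 3 = w 5 \<and> w 0 = w 4 \<and> w 1 = w 5)"
    by (rule W.aperiodic(1))
  \<comment> \<open>The word starts with \<open>aaa\<close>, \<open>abb\<close> or \<open>aab\<close>, as \<open>aba\<close> would give it period two.\<close>
  then consider "w 0 = w 1 \<and> w 1 = w 2 \<and> w 3 = w 4 \<and> w 4 = w 5 \<and> w 2 \<noteq> w 3"
    | "w 1 = w 2 \<and> w 2 = w 3 \<and> w 4 = w 5 \<and> w 5 = w 6 \<and> w 3 \<noteq> w 4"
    | "w 2 = w 3 \<and> w 3 = w 4 \<and> w 5 = w 6 \<and> w 6 = w 7 \<and> w 4 \<noteq> w 5"
    using anti(1) w67 by argo
  then have "\<exists>s. w s = w (1 + s) \<and> w (1 + s) = w (2 + s) \<and> w (3 + s) = w (4 + s) \<and> w (4 + s) = w (5 + s) \<and> w (2 + s) \<noteq> w (3 + s)"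
  proof cases
    case 1
    then show ?thesis
      by (intro exI[of _ 0]) (simp add: numeral_eq_Suc)
  next
    case 2
    then show ?thesis
      by (intro exI[of _ 1]) (simp add: numeral_eq_Suc)
  next
    case 3
    then show ?thesis
      by (intro exI[of _ 2]) (simp add: numeral_eq_Suc)
  qed
  then obtain s where s: "w s = w (1 + s)" "w (1 + s) = w (2 + s)" "w (3 + s) = w (4 + s)" "w (4 + s) = w (5 + s)" "w (2 + s) \<noteq> w (3 + s)"
    by blast
  have "\<not> (u s = u (1 + s) \<and> u (1 + s) = u (2 + s))"
  proof
    assume "u s = u (1 + s) \<and> u (1 + s) = u (2 + s)"
    moreover have "distinct [s mod n, (1 + s) mod n, (2 + s) mod n]"
      using mod_neq_add[of 0 1 s] mod_neq_add[of 0 2 s] mod_neq_add[of 1 2 s] by (simp add: n6)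
    ultimately show False
      using no_three_same[OF n5, of s "1 + s" "2 + s"] s by metis
  qed
  moreover have "\<not> (u (3 + s) = u (4 + s) \<and> u (4 + s) = u (5 + s))"
  proof
    assume "u (3 + s) = u (4 + s) \<and> u (4 + s) = u (5 + s)"
    moreover have "distinct [(3 + s) mod n, (4 + s) mod n, (5 + s) mod n]"
      using mod_neq_add[of 3 4 s] mod_neq_add[of 3 5 s] mod_neq_add[of 4 5 s] by (simp add: n6)
    ultimately show False
      using no_three_same[OF n5, of "3 + s" "4 + s" "5 + s"] s by metis
  qed
  moreover have "\<bar>X (i + s) + X (j + s)\<bar> = 2 * (q ^ binary_code6.k (\<lambda>i. u (i + s)) (\<lambda>i j. eu (i + s) (j + s)) i j
      * P ^ binary_code6.k (\<lambda>i. w (i + s)) (\<lambda>i j. ew (i + s) (j + s)) i j)" if "i < j" "j < 6" for i j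
  proof -
    have "i mod n \<noteq> j mod n"
      using that n6 by simp
    then have "(i + s) mod n \<noteq> (j + s) mod n"
      by (rule mod_neq_add)
    from abs_sum_eq[OF this] show ?thesis
      by (simp add: binary_code6.k_def[OF U.shift] binary_code6.k_def[OF W.shift] U.k_def W.k_def)
  qed
  ultimately show False
    using no_antipodal_codes[OF U.shift[of s] W.shift[of s], of q P "\<lambda>i. X (i + s)"]
      s q_ge_2 q_le even_q P_ge_3 coprime_P_q by simp
qed

end

lemma (in two_prime_cycle) n_eq_3: "n = 3"
proof -
  have "n \<noteq> 6"
  proof
    assume "n = 6"
    then interpret six_cycle X A D n p
      by unfold_locales
    show False
      by (rule six_cycle_impossible)
  qed
  then show ?thesis
    using n_ge_3 n_neq_4 n_neq_5 n_le_6 by linarith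
qed

section \<open>From rational cycles to integral ones\<close>

lemma funpow_eq_iff_mod_period:
  assumes "periodic_point f x"
  shows "(f ^^ i) x = (f ^^ j) x \<longleftrightarrow> i mod period f x = j mod period f x"
    and "1 \<le> period f x"
proof -
  let ?n = "period f x"
  let ?P = "\<lambda>n. n \<ge> 1 \<and> (f ^^ n) x = x"
  have "\<exists>n. ?P n"
    using assms by (auto simp: periodic_point_def)
  then have n: "?P ?n"
    unfolding period_def by (rule LeastI_ex)
  then show "1 \<le> ?n"
    by simp
  have least: "?n \<le> m" if "?P m" for m
    unfolding period_def using that by (rule Least_le)
  have mod: "(f ^^ i) x = (f ^^ (i mod ?n)) x" for i
    using n by (simp add: funpow_mod_eq)
  have inj: False if "i < j" "j < ?n" "(f ^^ i) x = (f ^^ j) x" for i j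
  proof -
    have "(f ^^ (?n - j + i)) x = (f ^^ (?n - j + j)) x"
      using that(3) by (simp add: funpow_add)
    also have "\<dots> = x"
      using that(2) n by simp
    finally show False
      using least[of "?n - j + i"] that by linarith
  qed
  have "i mod ?n = j mod ?n" if "(f ^^ i) x = (f ^^ j) x"
    using inj[of "i mod ?n" "j mod ?n"] inj[of "j mod ?n" "i mod ?n"] that mod[of i] mod[of j] n
    by (metis linorder_neqE_nat mod_less_divisor zero_less_one order_less_le_trans)
  then show "(f ^^ i) x = (f ^^ j) x \<longleftrightarrow> i mod ?n = j mod ?n"
    using mod by metis
qed

lemma rat_common_denominator:
  fixes y :: "nat \<Rightarrow> rat"
  assumes "\<And>i. y i = y (i mod n)" "0 < n"
  shows "\<exists>d::nat. 0 < d \<and> (\<forall>i. of_nat d * y i \<in> \<int>)"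
proof -
  define d where "d i = nat (snd (quotient_of (y i)))" for i
  have pos: "0 < d i" for i
    by (simp add: d_def quotient_of_denom_pos')
  have int: "of_nat (d i) * y i \<in> \<int>" for i
  proof -
    have "of_nat (d i) = (of_int (snd (quotient_of (y i))) :: rat)"
      using quotient_of_denom_pos'[of "y i"] by (simp add: d_def of_nat_nat)
    moreover have "y i = of_int (fst (quotient_of (y i))) / of_int (snd (quotient_of (y i)))"
      using quotient_of_div[of "y i"] by (metis prod.collapse)
    ultimately have "of_nat (d i) * y i = of_int (fst (quotient_of (y i)))"
      using quotient_of_denom_pos'[of "y i"] by (metis less_int_code(1) nonzero_mult_div_cancel_left of_int_eq_0_iff times_divide_eq_right)
    then show ?thesis
      by simp
  qed
  have "of_nat (\<Prod>i<n. d i) * y i \<in> \<int>" for i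
  proof -
    have "d (i mod n) dvd (\<Prod>i<n. d i)"
      using assms(2) by (intro dvd_prodI) auto
    then obtain e where "(\<Prod>i<n. d i) = d (i mod n) * e" ..
    then have "of_nat (\<Prod>i<n. d i) * y i = of_nat e * (of_nat (d (i mod n)) * y (i mod n))"
      using assms(1)[of i] by (simp add: mult_ac)
    then show ?thesis
      using int by (metis Ints_mult Ints_of_nat)
  qed
  moreover have "0 < (\<Prod>i<n. d i)"
    using pos by (simp add: prod_pos)
  ultimately show ?thesis
    by blast
qed

lemma den_eqI:
  assumes "coprime a b" "0 < b" "c = of_int a / of_int b"
  shows "den c = b"
proof -
  have "quotient_of c = Rat.normalize (a, b)"
    using assms(3) by (metis Fract_of_int_quotient quotient_of_Fract)
  then show ?thesis
    using assms(1,2) by (simp add: den_def normalize_stable)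
qed

text \<open>Take the least common denominator \<open>D\<close>. A prime dividing \<open>D\<close> and \<open>A\<close>, or \<open>D\<close> and one \<open>X\<^sub>i\<close>, divides all
\<open>X\<^sub>j\<close>, because \<open>X\<^sub>j\<^sup>2 \<equiv> A\<close> modulo \<open>D\<close>; it could then be cancelled from \<open>D\<close>.\<close>

lemma integral_cycle_of_periodic_point:
  fixes c x :: rat
  assumes per: "periodic_point (phi c) x"
  shows "\<exists>X A D. integral_cycle X A D (period (phi c) x) \<and> den c = D\<^sup>2"
proof -
  define n where "n = period (phi c) x"
  define y where "y i = (phi c ^^ i) x" for i
  have y_inj: "y i = y j \<longleftrightarrow> i mod n = j mod n" for i j
    using funpow_eq_iff_mod_period(1)[OF per] by (simp add: y_def n_def)
  have n: "0 < n"
    using funpow_eq_iff_mod_period(2)[OF per] by (simp add: n_def)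
  have y_step: "y (Suc i) = (y i)\<^sup>2 - c" for i
    by (simp add: y_def phi_def)
  define Q where "Q d \<longleftrightarrow> 0 < d \<and> (\<forall>i. of_nat d * y i \<in> \<int>)" for d :: nat
  have "\<exists>d. Q d"
    unfolding Q_def using y_inj n by (intro rat_common_denominator[of y n]) auto
  define d where "d = (LEAST d. Q d)"
  have d: "Q d"
    unfolding d_def using \<open>\<exists>d. Q d\<close> by (rule LeastI_ex)
  have minimal: "d \<le> e" if "Q e" for e
    unfolding d_def using that by (rule Least_le)
  define D where "D = int d"
  have D: "0 < D"
    using d by (simp add: D_def Q_def)
  define X where "X i = \<lfloor>of_nat d * y i\<rfloor>" for i
  have X: "of_int (X i) = of_int D * y i" for i
    using d by (simp add: X_def Q_def D_def)
  define A where "A = (X 0)\<^sup>2 - D * X 1"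
  have c: "of_int ((X i)\<^sup>2 - D * X (Suc i)) = (of_int D)\<^sup>2 * c" for i
    by (simp add: X y_step power2_eq_square algebra_simps)
  have "(of_int ((X i)\<^sup>2 - D * X (Suc i)) :: rat) = of_int A" for i
    using c[of i] c[of 0] by (simp only: A_def One_nat_def)
  then have step: "(X i)\<^sup>2 - D * X (Suc i) = A" for i
    by (simp only: of_int_eq_iff)
  have no_common: False if l: "prime l" "l dvd D" "l dvd A" for l
  proof -
    have dvd_X: "l dvd X i" for i
    proof -
      have "(X i)\<^sup>2 = A + D * X (Suc i)"
        using step[of i] by simp
      then have "l dvd (X i)\<^sup>2"
        using l by simp
      then show ?thesis
        using l(1) prime_dvd_power by blast
    qed
    have l2: "2 \<le> l"
      using l(1) by (rule prime_ge_2_int)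
    obtain D' where D': "D = l * D'"
      using l(2) ..
    then have pos: "0 < D'"
      using D l2 by (simp add: zero_less_mult_iff)
    have "of_nat (nat D') * y i \<in> \<int>" for i
    proof -
      obtain z where "X i = l * z"
        using dvd_X[of i] ..
      then have "(of_int l :: rat) * of_int z = of_int l * (of_int D' * y i)"
        using X[of i] D' by (simp add: mult_ac flip: of_int_mult)
      then have "of_int D' * y i = of_int z"
        using l2 by simp
      then show ?thesis
        using pos by (simp add: of_nat_nat)
    qed
    then have "Q (nat D')"
      using pos by (simp add: Q_def)
    then have "D \<le> D'"
      using minimal[of "nat D'"] pos by (simp add: D_def)
    moreover have "2 * D' \<le> l * D'"
      using l2 pos by (intro mult_right_mono) auto
    ultimately show False
      using D' pos by linarith
  qed
  have "coprime (X i) D" for i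
  proof -
    have "coprime D (X i)"
    proof (rule coprime_if_no_common_prime)
      fix l assume "prime l" "l dvd D" "l dvd X i"
      moreover from this have "l dvd (X i)\<^sup>2 - D * X (Suc i)"
        by (simp add: power2_eq_square)
      ultimately show False
        using no_common step by metis
    qed (use D in simp)
    then show ?thesis
      by (simp add: coprime_commute)
  qed
  moreover have "X i = X j \<longleftrightarrow> i mod n = j mod n" for i j
  proof -
    have "X i = X j \<longleftrightarrow> (of_int (X i) :: rat) = of_int (X j)"
      by simp
    also have "\<dots> \<longleftrightarrow> y i = y j"
      using D by (simp add: X)
    finally show ?thesis
      by (simp add: y_inj)
  qed
  moreover have "D * X (Suc i) = (X i)\<^sup>2 - A" for i
    using step[of i] by simp
  ultimately have "integral_cycle X A D n"
    using D n by unfold_locales auto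
  moreover have "den c = D\<^sup>2"
  proof (rule den_eqI)
    have "coprime D A"
      using D no_common by (intro coprime_if_no_common_prime) auto
    then show "coprime A (D\<^sup>2)"
      by (simp add: coprime_commute)
    have "of_int A = (of_int D)\<^sup>2 * c"
      using c[of 0] step[of 0] by simp
    then show "c = of_int A / of_int (D\<^sup>2)"
      using D by (simp add: field_simps)
  qed (use D in simp)
  ultimately show ?thesis
    unfolding n_def by blast
qed

theorem theorem3p16:
  fixes c :: rat
  assumes "card (prime_factors (den c)) \<le> 2"
  shows "\<forall>x. periodic_point (phi c) x \<longrightarrow> period (phi c) x \<le> 3"
proof (intro allI impI)
  fix x assume "periodic_point (phi c) x"
  then obtain X A D where "integral_cycle X A D (period (phi c) x)" and den: "den c = D\<^sup>2"
    using integral_cycle_of_periodic_point by blast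
  then interpret integral_cycle X A D "period (phi c) x"
    by simp
  show "period (phi c) x \<le> 3"
  proof (rule ccontr)
    assume "\<not> period (phi c) x \<le> 3"
    then have n: "3 \<le> period (phi c) x"
      by simp
    have primes: "prime_factors D = prime_factors (den c)"
      using D_pos by (auto simp: den prime_factors_dvd prime_dvd_power_iff)
    have two: "2 \<in> prime_factors D"
      using even_D[OF n] D_pos by (auto simp: prime_factors_dvd)
    have "card (prime_factors D - {2}) \<le> 1"
      using assms two primes by (simp add: card_Diff_singleton)
    then obtain p where "prime p" "odd p" "prime_factors D - {2} \<subseteq> {p}"
    proof (cases "prime_factors D - {2} = {}")
      case True
      \<comment> \<open>When \<open>D\<close> is a power of two, any odd prime may serve as \<open>p\<close>.\<close>
      have "prime (3::int)" "odd (3::int)"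
        by simp_all
      then show ?thesis
        using that[of 3] True by blast
    next
      case False
      then obtain p where p: "p \<in> prime_factors D" "p \<noteq> 2"
        by blast
      then have "prime p"
        by auto
      moreover from this have "odd p"
        using p(2) primes_dvd_imp_eq[of 2 p] by auto
      moreover have "prime_factors D - {2} \<subseteq> {p}"
        using \<open>card (prime_factors D - {2}) \<le> 1\<close> p card_le_Suc0_iff_eq[of "prime_factors D - {2}"] by auto
      ultimately show ?thesis
        using that by blast
    qed
    then have "two_prime_cycle X A D (period (phi c) x) p"
      using n D_pos by unfold_locales (auto simp: prime_factors_dvd)
    then have "period (phi c) x = 3"
      by (rule two_prime_cycle.n_eq_3)
    then show False
      using \<open>\<not> period (phi c) x \<le> 3\<close> by simp
  qed
qed

end
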